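(* Let $\mathbf{X}=(\mathbf{x}_1,\dots,\mathbf{x}_n)^\top$ have i.i.d. $\mathrm{Bernoulli}(\boldsymbol\mu)$ rows, i.e. $\mathbf{x}_i\in\{0,1\}^d$ with $\mathbb{E}[\mathbf{x}_i]=\boldsymbol\mu$ (so that $\|\mathbf{x}_i\|_\infty\le\zeta$ with $\zeta=1$). Let $\varepsilon,\delta\in(0,1)$ and $\beta\in(0,1)$. For $t\in\{1,\dots,n\}$ let $\widehat{\boldsymbol\mu}_t$ be the private running mean produced by the matrix factorization mechanism with correlation matrix $\mathbf{C}$ and $\mathbf{B}=\mathbf{A}\mathbf{C}^{-1}$, under the $b$-min-separation condition with at most $k=\lceil n/b\rceil$ participations per user. Then, for each of the following choices of $\mathbf{C}$, the stated bound on $\|\widehat{\boldsymbol\mu}_t-\boldsymbol\mu\|_2$ holds with probability $1-2\beta$: 1. (Not banded) $\mathbf{C}=\mathbf{D}_{\mathrm{Toep}}$: $$O\left(\sqrt{\frac{d\zeta^2}{t}\ln\frac{d}{\beta}}+\frac{\sqrt{d\ln\frac1\delta}}{\varepsilon\sqrt t\,\ln t}\left(\sqrt k+\frac{k}{\sqrt n}\sqrt{\ln k\ln n}\right)\left(\sqrt d+\sqrt{\ln\tfrac1\beta}\right)\right).$$ 2. (Not banded) $\mathbf{C}=\mathbf{E}_1^{1/2}$: $$O\left(\sqrt{\frac{d\zeta^2}{t}\ln\frac{d}{\beta}}+\frac{\sqrt{d\ln t\,\ln\frac1\delta}\,\left(\sqrt{k\ln n}+k\right)}{\varepsilon t}\left(\sqrt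 d+\sqrt{\ln\tfrac1\beta}\right)\right).$$ 3. (Banded inverse) $\mathbf{C}=\mathbf{D}_{\mathrm{Toep}}^{p}$ with bandwidth $p=b$: $$O\left(\sqrt{\frac{d\zeta^2}{t}\ln\frac{d}{\beta}}+\frac{\sqrt{dk\ln\frac1\delta}}{\varepsilon\sqrt{t\ln(n/k)}}\left(1+\sqrt{\frac{n}{kt}}\right)\left(\sqrt d+\sqrt{\ln\tfrac1\beta}\right)\right).$$ 4. (Banded inverse) $\mathbf{C}=(\mathbf{E}_1^{1/2})^{p}$ with bandwidth $p=\lceil\ln b\rceil$: $$O\left(\sqrt{\frac{d\zeta^2}{t}\ln\frac{d}{\beta}}+\frac{\sqrt{dk}}{\varepsilon\sqrt t}\sqrt{\ln\tfrac1\delta}\left(\sqrt{\ln\ln\tfrac nk}+\sqrt{\frac{k\ln\frac nk}{n}}\right)\left(\frac{\sqrt k}{\sqrt{\ln\frac nk}}+\frac{\sqrt{\ln\ln\frac nk}}{\sqrt t}\right)\left(\sqrt d+\sqrt{\ln\tfrac1\beta}\right)\right).$$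
   Context: All matrices other than $\mathbf{X},\mathbf{Z}$ are $n\times n$. $\mathbf{A}_{i,j}=1/i$ for $j\le i$, $0$ otherwise. $\mathbf{D}_{\mathrm{Toep}}$ is lower-triangular Toeplitz with entries $\frac1{i-j+1}$ for $j\le i$. $\mathbf{E}_1$ is the prefix-sum matrix (entries $1$ for $j\le i$, $0$ otherwise) and $\mathbf{E}_1^{1/2}$ its lower-triangular Toeplitz square root, with entries $r_{i-j}$ for $j\le i$, $r_m=\left|\binom{-1/2}{m}\right|$. Banded inverse: for an invertible lower-triangular Toeplitz $\mathbf{C}$ and bandwidth $p>0$, $\mathbf{C}^p$ (a notation, not a power) is the matrix whose inverse is obtained from $\mathbf{C}^{-1}$ by keeping the entries with $0\le i-j<p$ and setting all others to zero. $b$-min-separation: any two participations of a single user are at least $b$ steps apart; $k=\lceil n/b\rceil$ is the maximum number of participations. Sensitivity: $\Pi_{k,b}$ is the family of subsets $\pi\subseteq\{1,\dots,n\}$ with $|\pi|\le k$ such that any two distinct $i,j\in\pi$ satisfy $|i-j|\ge b$, and $$\mathrm{sens}_{k,b}(\mathbf{C})=\max_{\pi\in\Pi_{k,b}}\ \max_{(x_i)_{i\in\pi},\ x_i\in\mathbb{R}^d,\ \|x_i\|_2\le1}\Big\|\sum_{i\in\pi}\mathbf{C}_{:,i}\,x_i^\top\Big\|_F .$$ Matrix factorization mechanism: $\widehat{\mathbf{Y}}=\mathbf{B}(\mathbf{C}\mathbf{X}+\mathbf{Z})=\mathbf{A}\mathbf{X}+\mathbf{B}\mathbf{Z}$, where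 $\mathbf{Z}\in\mathbb{R}^{n\times d}$ is independent of $\mathbf{X}$ with i.i.d. entries $\mathcal N\big(0,\sigma_{\varepsilon,\delta}^2\,d\zeta^2\,\mathrm{sens}_{k,b}^2(\mathbf{C})\big)$ and $\sigma_{\varepsilon,\delta}=\frac1\varepsilon\sqrt{2\ln(1.25/\delta)}$. $\widehat{\boldsymbol\mu}_t$ is the $t$-th row of $\widehat{\mathbf{Y}}$.
   Formalization: The O-constant is uniform only for δ≤δ₀ (any fixed δ₀<1), as the noise has ln(1.25/δ) but the bound ln(1/δ); items 1, 2 need t≥2, item 3 n/k>1, item 4 ln(n/k)≥1, where the formulas make sense or hold; b≤n is assumed; the constant is stated per sample space type. *)

theory Defs
  imports "HOL-Probability.Probability" "Jordan_Normal_Form.Gauss_Jordan_Elimination"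
begin

text \<open>
  All constants in the asymptotic bounds must be uniform in the dimensions, so matrices are the
  dimension-carrying matrices of \<open>Jordan_Normal_Form\<close>. They are indexed from 0: time step
  \<open>t \<in> {1..n}\<close> is row \<open>t - 1\<close>, and entry \<open>(i, j)\<close> below is the entry \<open>(i + 1, j + 1)\<close> in the
  usual 1-based notation.
\<close>

unbundle no vec_syntax

section \<open>Matrices\<close>

definition running_mean_mat :: "nat \<Rightarrow> real mat" where
  "running_mean_mat n = mat n n (\<lambda>(i, j). if j \<le> i then 1 / real (i + 1) else 0)"

definition D_Toep :: "nat \<Rightarrow> real mat" where
  "D_Toep n = mat n n (\<lambda>(i, j). if j \<le> i then 1 / real (i - j + 1) else 0)"

definition E1 :: "nat \<Rightarrow> real mat" where
  "E1 n = mat n n (\<lambda>(i, j). if j \<le> i then 1 else 0)"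

definition E1_sqrt :: "nat \<Rightarrow> real mat" where
  "E1_sqrt n = mat n n (\<lambda>(i, j). if j \<le> i then \<bar>(-1/2 :: real) gchoose (i - j)\<bar> else 0)"

lemma abs_gbinomial_minus_half:
  "\<bar>(-1/2 :: real) gchoose m\<bar> = (-1) ^ m * ((-1/2) gchoose m)"
proof -
  have "(-1/2 :: real) gchoose m = (-1) ^ m * ((1/2 + real m - 1) gchoose m)"
    using gbinomial_minus[of "1/2 :: real" m] by simp
  moreover have "(1/2 + real m - 1) gchoose m \<ge> 0"
    unfolding gbinomial_prod_rev
    by (intro divide_nonneg_nonneg prod_nonneg) auto
  ultimately show ?thesis
    by (simp add: abs_mult power_abs flip: mult.assoc power_mult_distrib)
qed

lemma E1_sqrt_square: "E1_sqrt n * E1_sqrt n = E1 n"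
proof (rule eq_matI)
  fix i j assume ij: "i < dim_row (E1 n)" "j < dim_col (E1 n)"
  hence i: "i < n" and j: "j < n" by (auto simp: E1_def)
  define r where "r m = \<bar>(-1/2 :: real) gchoose m\<bar>" for m
  have "(E1_sqrt n * E1_sqrt n) $$ (i, j) =
      (\<Sum>l\<in>{0..<n}. (if l \<le> i then r (i - l) else 0) * (if j \<le> l then r (l - j) else 0))"
    using i j by (simp add: E1_sqrt_def scalar_prod_def r_def cong: if_cong)
  also have "\<dots> = (\<Sum>l\<in>{j..i}. r (i - l) * r (l - j))"
    using i by (intro sum.mono_neutral_cong_right) auto
  also have "\<dots> = (if j \<le> i then 1 else 0)"
  proof (cases "j \<le> i")
    case True
    have "(\<Sum>l\<in>{j..i}. r (i - l) * r (l - j)) = (\<Sum>m\<le>i - j. r (i - j - m) * r m)"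
      by (rule sum.reindex_bij_witness[of _ "\<lambda>m. m + j" "\<lambda>l. l - j"])
         (use True in auto)
    also have "\<dots> = (\<Sum>m\<le>i - j. (-1) ^ (i - j) *
        (((-1/2) gchoose m) * ((-1/2) gchoose (i - j - m))))"
    proof (intro sum.cong refl)
      fix m assume "m \<in> {..i - j}"
      hence "(-1 :: real) ^ (i - j) = (-1) ^ (i - j - m) * (-1) ^ m"
        by (simp del: diff_diff_left flip: power_add)
      thus "r (i - j - m) * r m =
          (-1) ^ (i - j) * (((-1/2) gchoose m) * ((-1/2) gchoose (i - j - m)))"
        unfolding r_def abs_gbinomial_minus_half by (simp only: mult_ac)
    qed
    also have "\<dots> = (-1) ^ (i - j) * ((-1/2 + -1/2 :: real) gchoose (i - j))"
      by (subst gbinomial_Vandermonde [symmetric])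
         (simp add: sum_distrib_left atMost_atLeast0)
    also have "\<dots> = 1"
      using gbinomial_minus[of "1 :: real" "i - j"]
      by (simp flip: binomial_gbinomial power_mult_distrib)
    finally show ?thesis using True by simp
  qed auto
  also have "\<dots> = E1 n $$ (i, j)"
    using i j by (simp add: E1_def)
  finally show "(E1_sqrt n * E1_sqrt n) $$ (i, j) = E1 n $$ (i, j)" .
qed (auto simp: E1_def E1_sqrt_def)

definition mat_inv :: "real mat \<Rightarrow> real mat" where
  "mat_inv A = the (mat_inverse A)"

definition band :: "nat \<Rightarrow> real mat \<Rightarrow> real mat" where
  "band p A = mat (dim_row A) (dim_col A)
     (\<lambda>(i, j). if j \<le> i \<and> i - j < p then A $$ (i, j) else 0)"

definition banded_inverse :: "nat \<Rightarrow> real mat \<Rightarrow> real mat" where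
  "banded_inverse p C = mat_inv (band p (mat_inv C))"

definition vec_l2 :: "real vec \<Rightarrow> real" where
  "vec_l2 v = L2_set (\<lambda>i. v $ i) {..<dim_vec v}"

definition frobenius :: "real mat \<Rightarrow> real" where
  "frobenius A = L2_set (\<lambda>ij. A $$ ij) ({..<dim_row A} \<times> {..<dim_col A})"

section \<open>Participation and sensitivity\<close>

definition max_part :: "nat \<Rightarrow> nat \<Rightarrow> nat" where
  "max_part n b = nat \<lceil>real n / real b\<rceil>"

definition participations :: "nat \<Rightarrow> nat \<Rightarrow> nat \<Rightarrow> nat set set" where
  "participations n k b =
     {\<pi>. \<pi> \<subseteq> {..<n} \<and> card \<pi> \<le> k \<and>
         (\<forall>i\<in>\<pi>. \<forall>j\<in>\<pi>. i \<noteq> j \<longrightarrow> int b \<le> \<bar>int i - int j\<bar>)}"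

text \<open>
  The supremum is over a nonempty bounded set and is attained (finitely many \<open>\<pi>\<close>, compact unit
  balls), so it is the maximum. The matrix is the sum of the outer products
  \<open>C\<^bsub>:,i\<^esub> x\<^sub>i\<^sup>T\<close>, an \<open>n \<times> d\<close> matrix.
\<close>

definition sens :: "nat \<Rightarrow> nat \<Rightarrow> nat \<Rightarrow> real mat \<Rightarrow> real" where
  "sens d k b C =
     Sup {frobenius (mat (dim_row C) d (\<lambda>(r, c). \<Sum>i\<in>\<pi>. C $$ (r, i) * x i $ c)) | \<pi> x.
            \<pi> \<in> participations (dim_col C) k b \<and>
            (\<forall>i\<in>\<pi>. x i \<in> carrier_vec d \<and> vec_l2 (x i) \<le> 1)}"

section \<open>Random data and the matrix factorization mechanism\<close>

text \<open>
  The rows are independent and identically distributed, with values in \<open>{0,1}\<^sup>d\<close> and mean \<open>\<mu>\<close>;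
  the coordinates within one row may be dependent.
\<close>

definition bernoulli_rows ::
    "'w measure \<Rightarrow> nat \<Rightarrow> nat \<Rightarrow> real vec \<Rightarrow> ('w \<Rightarrow> real mat) \<Rightarrow> bool" where
  "bernoulli_rows M n d \<mu> X \<longleftrightarrow>
     (let R = PiM {..<d} (\<lambda>_. borel :: real measure);
          x = (\<lambda>i \<omega>. \<lambda>j\<in>{..<d}. X \<omega> $$ (i, j))
      in (\<forall>\<omega>\<in>space M. X \<omega> \<in> carrier_mat n d) \<and>
         prob_space.indep_vars M (\<lambda>_. R) x {..<n} \<and>
         (\<forall>i<n. \<forall>i'<n. distr M R (x i) = distr M R (x i')) \<and>
         (\<forall>i<n. AE \<omega> in M. \<forall>j<d. X \<omega> $$ (i, j) \<in> {0, 1}) \<and>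
         \<mu> \<in> carrier_vec d \<and>
         (\<forall>i<n. \<forall>j<d. integral\<^sup>L M (\<lambda>\<omega>. X \<omega> $$ (i, j)) = \<mu> $ j))"

definition gaussian_entries ::
    "'w measure \<Rightarrow> nat \<Rightarrow> nat \<Rightarrow> real \<Rightarrow> ('w \<Rightarrow> real mat) \<Rightarrow> bool" where
  "gaussian_entries M n d v Z \<longleftrightarrow>
     (\<forall>\<omega>\<in>space M. Z \<omega> \<in> carrier_mat n d) \<and>
     prob_space.indep_vars M (\<lambda>_. borel) (\<lambda>ij \<omega>. Z \<omega> $$ ij) ({..<n} \<times> {..<d}) \<and>
     (\<forall>ij \<in> {..<n} \<times> {..<d}.
        distributed M lborel (\<lambda>\<omega>. Z \<omega> $$ ij) (normal_density 0 (sqrt v)))"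

definition indep_matrices ::
    "'w measure \<Rightarrow> nat \<Rightarrow> nat \<Rightarrow> ('w \<Rightarrow> real mat) \<Rightarrow> ('w \<Rightarrow> real mat) \<Rightarrow> bool" where
  "indep_matrices M n d X Z \<longleftrightarrow>
     (let I = {..<n} \<times> {..<d}
      in prob_space.indep_var M
           (PiM I (\<lambda>_. borel)) (\<lambda>\<omega>. \<lambda>ij\<in>I. X \<omega> $$ ij)
           (PiM I (\<lambda>_. borel)) (\<lambda>\<omega>. \<lambda>ij\<in>I. Z \<omega> $$ ij))"

definition noise_sigma :: "real \<Rightarrow> real \<Rightarrow> real" where
  "noise_sigma \<epsilon> \<delta> = 1 / \<epsilon> * sqrt (2 * ln (1.25 / \<delta>))"

definition noise_variance ::
    "nat \<Rightarrow> nat \<Rightarrow> nat \<Rightarrow> real \<Rightarrow> real \<Rightarrow> real \<Rightarrow> real mat \<Rightarrow> real" where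
  "noise_variance d k b \<zeta> \<epsilon> \<delta> C =
     (noise_sigma \<epsilon> \<delta>)\<^sup>2 * real d * \<zeta>\<^sup>2 * (sens d k b C)\<^sup>2"

definition mf_mechanism :: "real mat \<Rightarrow> real mat \<Rightarrow> real mat \<Rightarrow> real mat \<Rightarrow> real mat" where
  "mf_mechanism B C X Z = B * (C * X + Z)"

definition private_mean :: "nat \<Rightarrow> real mat \<Rightarrow> real mat \<Rightarrow> real mat \<Rightarrow> nat \<Rightarrow> real vec" where
  "private_mean n C X Z t =
     row (mf_mechanism (running_mean_mat n * mat_inv C) C X Z) (t - 1)"

section \<open>The error rates\<close>

text \<open>
  Real logarithms and square roots are total in HOL, with \<open>1 / 0 = 0\<close>. The formulas below are
  meaningful only for \<open>t \<ge> 2\<close> (first two), \<open>n / k > 1\<close> (third) and \<open>ln (n / k) \<ge> 1\<close> (fourth);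
  their uses have to be guarded accordingly.
\<close>

definition sampling_rate :: "nat \<Rightarrow> real \<Rightarrow> real \<Rightarrow> nat \<Rightarrow> real" where
  "sampling_rate d \<zeta> \<beta> t = sqrt (real d * \<zeta>\<^sup>2 / real t * ln (real d / \<beta>))"

definition rate_D_Toep ::
    "nat \<Rightarrow> nat \<Rightarrow> nat \<Rightarrow> real \<Rightarrow> real \<Rightarrow> real \<Rightarrow> real \<Rightarrow> nat \<Rightarrow> real" where
  "rate_D_Toep n k d \<zeta> \<epsilon> \<delta> \<beta> t =
     sampling_rate d \<zeta> \<beta> t +
     sqrt (real d * ln (1 / \<delta>)) / (\<epsilon> * sqrt (real t) * ln (real t))
       * (sqrt (real k) + real k / sqrt (real n) * sqrt (ln (real k) * ln (real n)))
       * (sqrt (real d) + sqrt (ln (1 / \<beta>)))"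

definition rate_E1_sqrt ::
    "nat \<Rightarrow> nat \<Rightarrow> nat \<Rightarrow> real \<Rightarrow> real \<Rightarrow> real \<Rightarrow> real \<Rightarrow> nat \<Rightarrow> real" where
  "rate_E1_sqrt n k d \<zeta> \<epsilon> \<delta> \<beta> t =
     sampling_rate d \<zeta> \<beta> t +
     sqrt (real d * ln (real t) * ln (1 / \<delta>)) * (sqrt (real k * ln (real n)) + real k)
       / (\<epsilon> * real t)
       * (sqrt (real d) + sqrt (ln (1 / \<beta>)))"

definition rate_D_Toep_banded ::
    "nat \<Rightarrow> nat \<Rightarrow> nat \<Rightarrow> real \<Rightarrow> real \<Rightarrow> real \<Rightarrow> real \<Rightarrow> nat \<Rightarrow> real" where
  "rate_D_Toep_banded n k d \<zeta> \<epsilon> \<delta> \<beta> t =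
     sampling_rate d \<zeta> \<beta> t +
     sqrt (real d * real k * ln (1 / \<delta>)) / (\<epsilon> * sqrt (real t * ln (real n / real k)))
       * (1 + sqrt (real n / (real k * real t)))
       * (sqrt (real d) + sqrt (ln (1 / \<beta>)))"

definition rate_E1_sqrt_banded ::
    "nat \<Rightarrow> nat \<Rightarrow> nat \<Rightarrow> real \<Rightarrow> real \<Rightarrow> real \<Rightarrow> real \<Rightarrow> nat \<Rightarrow> real" where
  "rate_E1_sqrt_banded n k d \<zeta> \<epsilon> \<delta> \<beta> t =
     sampling_rate d \<zeta> \<beta> t +
     sqrt (real d * real k) / (\<epsilon> * sqrt (real t)) * sqrt (ln (1 / \<delta>))
       * (sqrt (ln (ln (real n / real k))) + sqrt (real k * ln (real n / real k) / real n))
       * (sqrt (real k) / sqrt (ln (real n / real k))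
            + sqrt (ln (ln (real n / real k))) / sqrt (real t))
       * (sqrt (real d) + sqrt (ln (1 / \<beta>)))"

end

(*
  Proof idea.  The error of the mechanism splits into the deviation of the empirical mean of the
  first t rows, bounded by Hoeffding's inequality, and the Gaussian vector (B Z)_t, whose norm is
  controlled through E exp(g^2 / 4) = sqrt 2.  Up to constants the second part is sens(C) times the
  norm of row t of B = A C^-1.

  Write C as the Toeplitz matrix of a sequence a and let c be the reciprocal power series of a, with
  partial sums S m.  Row t of B consists of the numbers S m / t for m < t, or S (min m (p - 1)) / t
  if C^-1 is truncated to p bands.  Both sequences a are positive and log-convex, so by Kaluza's
  theorem c m <= 0 for m >= 1.  Hence S decreases, and the convolution identity S * a = 1 bounds it
  from above and below.  For the same reason the p-banded version of a lies between 0 and a, has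
  total mass at most 1 / S (p - 1), and decays by the factor 1 - S (p - 1) over each block of p
  entries.

  Participations of one user are b apart, so the squared sensitivity is at most k times the sum of
  the autocorrelations of a over distances 0, b, 2 b, ..., (k - 1) b.
*)

theory Submission
  imports Defs
begin

section \<open>Reciprocals of log-convex sequences\<close>

text \<open>The bounds must hold with one constant for all \<open>n\<close>, \<open>b\<close>,
  \<open>d\<close>, \<open>t\<close>, so every estimate is an explicit inequality and no limit is
  taken. Two mechanisms carry this. First, all sequences involved are nonnegative, so the inner
  maximum over the \<open>x i\<close> is controlled by the case of one common unit vector, and
  sensitivity becomes a sum of Gram matrix entries. Second, logarithmic factors vary slowly:
  \<open>harm n\<close> exceeds \<open>harm m\<close> by at most a multiple of the fourth root of n
  / m, so sums of powers of \<open>harm\<close> can be compared with their last term.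

  A lower bound for \<open>S\<close> is wanted because \<open>S (p - 1)\<close> enters the banded
  sensitivity through 1 / S (p - 1)^2: one factor is the total mass of the banded sequence, the
  other a geometric series over the blocks.

  The noise scale contains ln (1.25 / \<delta>), the rates ln (1 / \<delta>). Their quotient is
  unbounded as \<delta> tends to 1, which is why the constant depends on an upper bound
  \<open>\<delta>\<^sub>0\<close> < 1 for \<delta>.\<close>

lemma fps_mult_nth_atMost: "fps_nth (f * g) m = (\<Sum>i\<le>m. fps_nth f i * fps_nth g (m - i))"
  by (simp add: fps_mult_nth atMost_atLeast0)

text \<open>Multiplication by \<open>u\<close> = 1 / (1 - X) forms partial sums, and
  \<open>(g * u) * f\<close> collapses to \<open>u\<close>.\<close>

lemma fps_reciprocal_partial_sums:
  fixes f g :: "real fps"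
  assumes "f * g = 1"
  shows "(\<Sum>i\<le>m. (\<Sum>l\<le>i. fps_nth g l) * fps_nth f (m - i)) = 1"
proof -
  define u where "u = (Abs_fps (\<lambda>_. 1) :: real fps)"
  have "(\<Sum>i\<le>m. (\<Sum>l\<le>i. fps_nth g l) * fps_nth f (m - i)) = fps_nth ((g * u) * f) m"
    by (simp add: fps_mult_nth_atMost u_def)
  also have "(g * u) * f = u" using assms by (metis mult.commute mult.left_commute mult.right_neutral)
  finally show ?thesis by (simp add: u_def)
qed

text \<open>\<open>a_ratio\<close> is log-convexity: the quotients a (i + 1) / a i increase with i,
  written without division and for arbitrary i \<le> m rather than for neighbours, as Kaluza's
  argument uses it.\<close>

locale kaluza_seq =
  fixes a :: "nat \<Rightarrow> real"
  assumes a_0: "a 0 = 1"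
    and a_pos: "a m > 0"
    and a_Suc_le: "a (Suc m) \<le> a m"
    and a_ratio: "i \<le> m \<Longrightarrow> a (Suc i) * a m \<le> a (Suc m) * a i"
begin

definition c :: "nat \<Rightarrow> real" where "c = fps_nth (inverse (Abs_fps a))"

definition S :: "nat \<Rightarrow> real" where "S m = (\<Sum>i\<le>m. c i)"

text \<open>First column of the banded-inverse matrix: \<open>fps_cutoff p\<close> keeps the first
  \<open>p\<close> diagonals of the inverse, and the outer reciprocal goes back to the correlation
  matrix. It does not depend on \<open>n\<close>.\<close>

definition banded :: "nat \<Rightarrow> nat \<Rightarrow> real" where
  "banded p = fps_nth (inverse (fps_cutoff p (inverse (Abs_fps a))))"

lemma a_antimono: "i \<le> j \<Longrightarrow> a j \<le> a i"
  using lift_Suc_antimono_le[of a, OF a_Suc_le] by blast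

lemma a_inverse: "Abs_fps a * inverse (Abs_fps a) = 1"
  by (rule inverse_mult_eq_1') (simp add: a_0)

lemma c_0: "c 0 = 1"
  by (simp add: c_def a_0)

lemma c_conv: "(\<Sum>i\<le>m. c i * a (m - i)) = (if m = 0 then 1 else 0)"
proof -
  have "(\<Sum>i\<le>m. c i * a (m - i)) = fps_nth (inverse (Abs_fps a) * Abs_fps a) m"
    by (simp add: fps_mult_nth_atMost c_def)
  thus ?thesis using a_inverse by (simp add: mult.commute)
qed

text \<open>Kaluza's theorem by strong induction. The convolution identities at \<open>l\<close> and
  \<open>Suc l\<close> are multiplied by \<open>a (Suc l)\<close> and \<open>a l\<close> and
  subtracted, which leaves \<open>- c (Suc l) * a l\<close> as a sum of nonnegative terms.\<close>

lemma c_nonpos: "m \<ge> 1 \<Longrightarrow> c m \<le> 0"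
proof (induction m rule: less_induct)
  case (less m)
  then obtain l where m: "m = Suc l" by (cases m) auto
  show ?case
  proof (cases "l = 0")
    case True
    thus ?thesis using c_conv[of 1] c_0 a_0 a_pos[of 1] by (simp add: m)
  next
    case False
    have 1: "(\<Sum>i\<le>l. c i * a (Suc l - i)) + c (Suc l) = 0"
      using c_conv[of "Suc l"] by (simp add: a_0)
    have 2: "(\<Sum>i\<le>l. c i * a (l - i)) = 0" using c_conv[of l] False by simp
    \<comment> \<open>The term for i = 0, the only one with positive \<open>c i\<close>, cancels
      exactly; for i \<ge> 1 both \<open>c i\<close> and the bracket are nonpositive.\<close>
    have "0 \<le> c i * a (Suc l - i) * a l - c i * a (l - i) * a (Suc l)" if "i \<le> l" for i
    proof (cases "i = 0")
      case False
      have "c i \<le> 0" using less.IH[of i] that False m by simp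
      moreover have "a (Suc l - i) * a l - a (Suc l) * a (l - i) \<le> 0"
        using a_ratio[of "l - i" l] that by (simp add: Suc_diff_le)
      ultimately have "0 \<le> c i * (a (Suc l - i) * a l - a (Suc l) * a (l - i))"
        by (rule mult_nonpos_nonpos)
      thus ?thesis by (simp add: algebra_simps)
    qed simp
    hence "0 \<le> (\<Sum>i\<le>l. c i * a (Suc l - i) * a l - c i * a (l - i) * a (Suc l))"
      by (intro sum_nonneg) simp
    also have "\<dots> = (\<Sum>i\<le>l. c i * a (Suc l - i)) * a l - (\<Sum>i\<le>l. c i * a (l - i)) * a (Suc l)"
      by (simp add: sum_subtractf sum_distrib_right)
    also have "\<dots> = - c (Suc l) * a l" using 1 2 by (simp add: add_eq_0_iff)
    finally show ?thesis using a_pos[of l] by (simp add: m mult_le_0_iff not_le[symmetric])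
  qed
qed

lemma S_0: "S 0 = 1" by (simp add: S_def c_0)

lemma S_Suc: "S (Suc m) = S m + c (Suc m)" by (simp add: S_def)

lemma S_antimono: "i \<le> j \<Longrightarrow> S j \<le> S i"
  by (rule lift_Suc_antimono_le[of S]) (simp_all add: S_Suc c_nonpos)

lemma S_le_1: "S m \<le> 1" using S_antimono[of 0 m] by (simp add: S_0)

text \<open>For m \<ge> 1, replacing every \<open>a (m - i)\<close> by the smaller
  \<open>a m\<close> can only increase the vanishing convolution, since \<open>c i\<close> \<le> 0
  except at i = 0, where nothing changes. The result is \<open>S m * a m\<close>.\<close>

lemma S_nonneg: "S m \<ge> 0"
proof (cases "m = 0")
  case False
  have "c i * a (m - i) \<le> c i * a m" if "i \<le> m" for i
    using that c_nonpos[of i] a_antimono[of "m - i" m] by (cases "i = 0") (auto intro: mult_left_mono_neg)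
  hence "(\<Sum>i\<le>m. c i * a (m - i)) \<le> (\<Sum>i\<le>m. c i * a m)" by (intro sum_mono) simp
  also have "\<dots> = S m * a m" by (simp add: S_def sum_distrib_right)
  finally have "0 \<le> S m * a m" using c_conv[of m] False by simp
  thus ?thesis using a_pos[of m] by (simp add: zero_le_mult_iff)
qed (simp add: S_0)

lemma S_conv: "(\<Sum>i\<le>m. S i * a (m - i)) = 1"
  using fps_reciprocal_partial_sums[OF a_inverse, of m] by (simp add: S_def c_def)

lemma S_upper: "S m * (\<Sum>i\<le>m. a i) \<le> 1"
proof -
  have "S m * (\<Sum>i\<le>m. a i) = (\<Sum>i\<le>m. S m * a (m - i))"
    unfolding sum_distrib_left by (rule sum.reindex_bij_witness[of _ "\<lambda>i. m - i" "\<lambda>i. m - i"]) auto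
  also have "\<dots> \<le> (\<Sum>i\<le>m. S i * a (m - i))"
    by (intro sum_mono mult_right_mono S_antimono less_imp_le[OF a_pos]) simp
  finally show ?thesis by (simp add: S_conv)
qed

text \<open>In the identity at index m + l + 1, the first m + 1 terms have \<open>S i\<close> \<le>
  1 and lag at least l + 1; in the others \<open>S i\<close> is at most \<open>S m\<close>. The free
  parameter \<open>l\<close> is later chosen to keep the first part at 1 / 2.\<close>

lemma S_lower: "1 \<le> real (Suc m) * a (Suc l) + S m * (\<Sum>i\<le>l. a i)"
proof -
  let ?N = "m + Suc l"
  have "1 = (\<Sum>i\<le>?N. S i * a (?N - i))" by (simp only: S_conv)
  also have "{..?N} = {..m} \<union> {Suc m..?N}" by auto
  also have "(\<Sum>i\<in>\<dots>. S i * a (?N - i)) =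
      (\<Sum>i\<le>m. S i * a (?N - i)) + (\<Sum>i\<in>{Suc m..?N}. S i * a (?N - i))"
    by (rule sum.union_disjoint) auto
  also have "(\<Sum>i\<le>m. S i * a (?N - i)) \<le> (\<Sum>i\<le>m. 1 * a (Suc l))"
    by (intro sum_mono mult_mono S_le_1 a_antimono less_imp_le[OF a_pos]) auto
  also have "(\<Sum>i\<in>{Suc m..?N}. S i * a (?N - i)) \<le> (\<Sum>i\<in>{Suc m..?N}. S m * a (?N - i))"
    by (intro sum_mono mult_right_mono S_antimono less_imp_le[OF a_pos]) auto
  also have "\<dots> = (\<Sum>i\<le>l. S m * a i)"
    by (rule sum.reindex_bij_witness[of _ "\<lambda>i. ?N - i" "\<lambda>i. ?N - i"]) auto
  finally show ?thesis by (simp add: sum_distrib_left)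
qed

section \<open>Reciprocals of truncated reciprocals\<close>

context
  fixes p :: nat
  assumes p: "p \<ge> 1"
begin

lemma banded_inverse: "inverse (fps_cutoff p (inverse (Abs_fps a))) * fps_cutoff p (inverse (Abs_fps a)) = 1"
  by (rule inverse_mult_eq_1) (use p in \<open>simp add: a_0\<close>)

lemma banded_conv: "(\<Sum>i\<le>m. (if i < p then c i else 0) * banded p (m - i)) = (if m = 0 then 1 else 0)"
proof -
  have "(\<Sum>i\<le>m. (if i < p then c i else 0) * banded p (m - i)) =
     fps_nth (fps_cutoff p (inverse (Abs_fps a)) * inverse (fps_cutoff p (inverse (Abs_fps a)))) m"
    by (simp add: fps_mult_nth_atMost c_def banded_def if_distrib cong: if_cong)
  thus ?thesis using banded_inverse by (simp add: mult.commute)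
qed

lemma banded_0: "banded p 0 = 1"
  using banded_conv[of 0] p by (simp add: c_0)

text \<open>A renewal equation: the weights - c i for 1 \<le> i < p are nonnegative with total mass
  1 - S (p - 1). Positivity, comparison with \<open>a\<close> and decay are all read off from
  it.\<close>

lemma banded_rec:
  "m \<ge> 1 \<Longrightarrow> banded p m = (\<Sum>i=1..m. (if i < p then - c i else 0) * banded p (m - i))"
proof -
  assume m: "m \<ge> 1"
  have "{..m} = insert 0 {1..m}" by auto
  with banded_conv[of m] m p have "banded p m + (\<Sum>i=1..m. (if i < p then c i else 0) * banded p (m - i)) = 0"
    by (simp add: c_0)
  hence "banded p m = (\<Sum>i=1..m. - ((if i < p then c i else 0) * banded p (m - i)))"
    by (simp add: sum_negf)
  also have "\<dots> = (\<Sum>i=1..m. (if i < p then - c i else 0) * banded p (m - i))"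
    by (intro sum.cong) auto
  finally show ?thesis .
qed

lemma banded_nonneg: "banded p m \<ge> 0"
proof (induction m rule: less_induct)
  case (less m)
  show ?case
  proof (cases "m = 0")
    case False
    have "(\<Sum>i=1..m. (if i < p then - c i else 0) * banded p (m - i)) \<ge> 0"
      by (intro sum_nonneg mult_nonneg_nonneg less.IH) (auto simp: c_nonpos)
    thus ?thesis using False by (subst banded_rec) auto
  qed (simp add: banded_0)
qed

text \<open>\<open>a\<close> satisfies the same recursion without the cutoff, and the cutoff drops
  only nonnegative terms.\<close>

lemma banded_le: "banded p m \<le> a m"
proof (induction m rule: less_induct)
  case (less m)
  show ?case
  proof (cases "m = 0")
    case False
    have "banded p m = (\<Sum>i=1..m. (if i < p then - c i else 0) * banded p (m - i))"
      using False by (subst banded_rec) auto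
    also have "\<dots> \<le> (\<Sum>i=1..m. - c i * a (m - i))"
      by (intro sum_mono mult_mono less.IH) (auto simp: c_nonpos banded_nonneg)
    also have "\<dots> = a m - (\<Sum>i\<le>m. c i * a (m - i))"
    proof -
      have "{..m} = insert 0 {1..m}" by auto
      thus ?thesis by (simp add: c_0 sum_negf)
    qed
    finally show ?thesis using c_conv[of m] False by simp
  qed (simp add: banded_0 a_0)
qed

lemma cutoff_partial_sum: "(\<Sum>i\<le>m. if i < p then c i else 0) = S (min m (p - 1))"
proof -
  have "(\<Sum>i\<le>m. if i < p then c i else 0) = (\<Sum>i\<in>{..m} \<inter> {i. i < p}. c i)"
    by (simp add: sum.inter_restrict)
  also have "{..m} \<inter> {i. i < p} = {..min m (p - 1)}" using p by auto
  finally show ?thesis by (simp add: S_def)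
qed

text \<open>The partial sums of the truncated reciprocal are \<open>S (min i (p - 1))\<close>, all
  at least \<open>S (p - 1)\<close>, and their convolution with \<open>banded p\<close> is
  identically 1.\<close>

lemma banded_sum: "S (p - 1) * (\<Sum>i\<le>m. banded p i) \<le> 1"
proof -
  have "S (p - 1) * (\<Sum>i\<le>m. banded p i) = (\<Sum>i\<le>m. S (p - 1) * banded p (m - i))"
    unfolding sum_distrib_left by (rule sum.reindex_bij_witness[of _ "\<lambda>i. m - i" "\<lambda>i. m - i"]) auto
  also have "\<dots> \<le> (\<Sum>i\<le>m. S (min i (p - 1)) * banded p (m - i))"
    by (intro sum_mono mult_right_mono S_antimono banded_nonneg) auto
  also have "\<dots> = 1"
    using fps_reciprocal_partial_sums[OF banded_inverse, of m]
    by (simp add: cutoff_partial_sum[unfolded c_def] banded_def)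
  finally show ?thesis .
qed

text \<open>Blocks have length \<open>b\<close>, the participation gap, rather than
  \<open>p\<close>. The recursion looks back fewer than p \<le> b entries, so from one block it
  reaches at worst the preceding one, and each passage costs the total weight 1 - S (p - 1).\<close>

lemma banded_decay:
  assumes "p \<le> b" "s * b + b \<le> m"
  shows "banded p m \<le> (1 - S (p - 1)) ^ s * a b"
  using assms(2)
proof (induction s arbitrary: m)
  case 0
  thus ?case using banded_le[of m] a_antimono[of b m] by simp
next
  case (Suc s)
  let ?q = "(1 - S (p - 1)) ^ s * a b"
  have q: "?q \<ge> 0" using S_le_1 less_imp_le[OF a_pos] by simp
  have "banded p m = (\<Sum>i=1..m. (if i < p then - c i else 0) * banded p (m - i))"
    using Suc.prems p assms(1) by (intro banded_rec) auto
  also have "\<dots> \<le> (\<Sum>i=1..m. (if i < p then - c i else 0) * ?q)"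
  proof (intro sum_mono)
    fix i assume i: "i \<in> {1..m}"
    have "- c i * banded p (m - i) \<le> - c i * ?q" if "i < p"
      using Suc.prems assms(1) that i c_nonpos[of i] by (intro mult_left_mono Suc.IH) auto
    thus "(if i < p then - c i else 0) * banded p (m - i) \<le> (if i < p then - c i else 0) * ?q" by simp
  qed
  also have "\<dots> = (\<Sum>i=1..m. (if i < p then - c i else 0)) * ?q"
    by (simp add: sum_distrib_right)
  also have "(\<Sum>i=1..m. (if i < p then - c i else 0)) = 1 - (\<Sum>i\<le>m. if i < p then c i else 0)"
  proof -
    have *: "(\<Sum>i=1..m. (if i < p then - c i else 0)) = - (\<Sum>i=1..m. (if i < p then c i else 0))"
      unfolding sum_negf[symmetric] by (rule sum.cong) auto
    have "{..m} = insert 0 {1..m}" by auto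
    thus ?thesis using p unfolding * by (simp add: c_0)
  qed
  also have "\<dots> \<le> 1 - S (p - 1)"
    unfolding cutoff_partial_sum using S_antimono[of "min m (p - 1)" "p - 1"] by simp
  finally show ?case using q by (simp add: mult_right_mono mult.assoc)
qed

end

end

section \<open>Toeplitz factorizations and sensitivity\<close>

text \<open>Lower-triangular Toeplitz matrices of size \<open>n\<close> are power series modulo X^n,
  so products and inverses can be computed with series.\<close>

definition toeplitz :: "nat \<Rightarrow> (nat \<Rightarrow> real) \<Rightarrow> real mat" where
  "toeplitz n f = mat n n (\<lambda>(i, j). if j \<le> i then f (i - j) else 0)"

lemma toeplitz_carrier [simp]: "toeplitz n f \<in> carrier_mat n n"
  and dim_row_toeplitz [simp]: "dim_row (toeplitz n f) = n"
  and dim_col_toeplitz [simp]: "dim_col (toeplitz n f) = n"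
  and index_toeplitz [simp]:
    "i < n \<Longrightarrow> j < n \<Longrightarrow> toeplitz n f $$ (i, j) = (if j \<le> i then f (i - j) else 0)"
  by (auto simp: toeplitz_def)

lemma toeplitz_mult:
  "toeplitz n (fps_nth f) * toeplitz n (fps_nth g) = toeplitz n (fps_nth (f * g))"
proof (rule eq_matI)
  fix i j assume "i < dim_row (toeplitz n (fps_nth (f * g)))" "j < dim_col (toeplitz n (fps_nth (f * g)))"
  hence i: "i < n" and j: "j < n" by auto
  have "(toeplitz n (fps_nth f) * toeplitz n (fps_nth g)) $$ (i, j) =
      (\<Sum>l\<in>{0..<n}. (if l \<le> i then fps_nth f (i - l) else 0) * (if j \<le> l then fps_nth g (l - j) else 0))"
    using i j by (simp add: scalar_prod_def cong: if_cong)
  also have "\<dots> = (\<Sum>l\<in>{j..i}. fps_nth f (i - l) * fps_nth g (l - j))"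
    using i by (intro sum.mono_neutral_cong_right) auto
  also have "\<dots> = (if j \<le> i then fps_nth (f * g) (i - j) else 0)"
  proof (cases "j \<le> i")
    case True
    have "(\<Sum>l\<in>{j..i}. fps_nth f (i - l) * fps_nth g (l - j)) =
        (\<Sum>m\<le>i - j. fps_nth f m * fps_nth g (i - j - m))"
      by (rule sum.reindex_bij_witness[of _ "\<lambda>m. i - m" "\<lambda>l. i - l"]) (use True in auto)
    thus ?thesis using True by (simp add: fps_mult_nth_atMost)
  qed auto
  finally show "(toeplitz n (fps_nth f) * toeplitz n (fps_nth g)) $$ (i, j) =
      toeplitz n (fps_nth (f * g)) $$ (i, j)"
    using i j by simp
qed auto

lemma toeplitz_one: "toeplitz n (fps_nth 1) = 1\<^sub>m n"
  by (rule eq_matI) auto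

text \<open>\<open>mat_inv\<close> is \<open>the\<close> of an option: \<open>None\<close> is
  excluded because a two-sided inverse makes \<open>A\<close> a unit of the matrix ring, and in the
  other case inverses are unique.\<close>

lemma mat_inv_eqI:
  assumes A: "A \<in> carrier_mat n n" and B: "B \<in> carrier_mat n n"
    and AB: "A * B = 1\<^sub>m n" and BA: "B * A = 1\<^sub>m n"
  shows "mat_inv A = B"
proof (cases "mat_inverse A")
  case None
  have "A \<in> Units (ring_mat TYPE(real) n ())"
    using A B AB BA by (auto simp: Units_def ring_mat_def)
  thus ?thesis using mat_inverse(1)[OF A None, where b = "()"] by blast
next
  case (Some B')
  from mat_inverse(2)[OF A this] have B': "B' * A = 1\<^sub>m n" "B' \<in> carrier_mat n n" by auto
  have "B' = B' * (A * B)" unfolding AB using B'(2) by simp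
  also have "\<dots> = (B' * A) * B" using A B B' by (metis assoc_mult_mat)
  also have "\<dots> = B" unfolding B'(1) using B by simp
  finally show ?thesis using Some by (simp add: mat_inv_def)
qed

lemma mat_inv_toeplitz:
  assumes "f * g = 1"
  shows "mat_inv (toeplitz n (fps_nth f)) = toeplitz n (fps_nth g)"
  using assms
  by (intro mat_inv_eqI[of _ n]) (simp_all add: toeplitz_mult toeplitz_one mult.commute)

text \<open>Banding a Toeplitz matrix is a cutoff of its series. With p \<ge> 1 the cutoff keeps the
  constant coefficient 1, so the second reciprocal exists as well.\<close>

lemma banded_inverse_toeplitz:
  assumes f: "fps_nth f 0 = 1" and p: "p \<ge> 1"
  shows "banded_inverse p (toeplitz n (fps_nth f)) =
    toeplitz n (fps_nth (inverse (fps_cutoff p (inverse f))))"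
proof -
  have "band p (toeplitz n (fps_nth (inverse f))) = toeplitz n (fps_nth (fps_cutoff p (inverse f)))"
    by (rule eq_matI) (auto simp: band_def)
  moreover have "f * inverse f = 1" using f by (intro inverse_mult_eq_1') simp
  moreover have "fps_cutoff p (inverse f) * inverse (fps_cutoff p (inverse f)) = 1"
    using f p by (intro inverse_mult_eq_1') simp
  ultimately show ?thesis by (simp add: banded_inverse_def mat_inv_toeplitz)
qed

lemma running_mean_mult_toeplitz:
  assumes "i < n" "j < n"
  shows "(running_mean_mat n * toeplitz n f) $$ (i, j) =
    (if j \<le> i then (\<Sum>l\<le>i - j. f l) / real (i + 1) else 0)"
proof -
  have "(running_mean_mat n * toeplitz n f) $$ (i, j) =
      (\<Sum>l\<in>{0..<n}. (if l \<le> i then 1 / real (i + 1) else 0) * (if j \<le> l then f (l - j) else 0))"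
    using assms by (simp add: running_mean_mat_def scalar_prod_def cong: if_cong)
  also have "\<dots> = (\<Sum>l\<in>{j..i}. 1 / real (i + 1) * f (l - j))"
    using assms by (intro sum.mono_neutral_cong_right) auto
  also have "\<dots> = (if j \<le> i then (\<Sum>l\<le>i - j. 1 / real (i + 1) * f l) else 0)"
  proof (cases "j \<le> i")
    case True
    have "(\<Sum>l\<in>{j..i}. 1 / real (i + 1) * f (l - j)) = (\<Sum>l\<le>i - j. 1 / real (i + 1) * f l)"
      by (rule sum.reindex_bij_witness[of _ "\<lambda>l. l + j" "\<lambda>l. l - j"]) (use True in auto)
    thus ?thesis using True by simp
  qed auto
  finally show ?thesis by (simp add: sum_divide_distrib)
qed

section \<open>From sensitivity to autocorrelations\<close>

lemma L2_set_sum_le: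
  assumes "finite I"
  shows "L2_set (\<lambda>c. \<Sum>i\<in>I. f i c) A \<le> (\<Sum>i\<in>I. L2_set (f i) A)"
  using assms
proof (induction I rule: finite_induct)
  case (insert i I)
  have "L2_set (\<lambda>c. \<Sum>i\<in>insert i I. f i c) A = L2_set (\<lambda>c. f i c + (\<Sum>i\<in>I. f i c)) A"
    using insert by simp
  also have "\<dots> \<le> L2_set (f i) A + L2_set (\<lambda>c. \<Sum>i\<in>I. f i c) A"
    by (rule L2_set_triangle_ineq)
  finally show ?case using insert by simp
qed (simp add: L2_set_def)

lemma frobenius_sq_eq:
  "(frobenius A)\<^sup>2 = (\<Sum>r<dim_row A. (L2_set (\<lambda>c. A $$ (r, c)) {..<dim_col A})\<^sup>2)"
  by (simp add: frobenius_def L2_set_def sum_nonneg sum.cartesian_product)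

text \<open>Row by row, the triangle inequality and the nonnegative entries remove the unit-ball
  vectors \<open>x i\<close>; the squared row sums then expand into entries of the Gram matrix of
  the participating columns.\<close>

lemma frobenius_participation_le:
  assumes C: "\<And>r i. r < dim_row C \<Longrightarrow> i \<in> \<pi> \<Longrightarrow> 0 \<le> C $$ (r, i)"
    and fin: "finite \<pi>" and x: "\<And>i. i \<in> \<pi> \<Longrightarrow> x i \<in> carrier_vec d \<and> vec_l2 (x i) \<le> 1"
  shows "(frobenius (mat (dim_row C) d (\<lambda>(r, c). \<Sum>i\<in>\<pi>. C $$ (r, i) * x i $ c)))\<^sup>2
    \<le> (\<Sum>i\<in>\<pi>. \<Sum>j\<in>\<pi>. \<Sum>r<dim_row C. C $$ (r, i) * C $$ (r, j))"
proof -
  have "(L2_set (\<lambda>c. \<Sum>i\<in>\<pi>. C $$ (r, i) * x i $ c) {..<d})\<^sup>2 \<le> (\<Sum>i\<in>\<pi>. C $$ (r, i))\<^sup>2"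
    if r: "r < dim_row C" for r
  proof (rule power_mono)
    have "L2_set (\<lambda>c. \<Sum>i\<in>\<pi>. C $$ (r, i) * x i $ c) {..<d}
        \<le> (\<Sum>i\<in>\<pi>. L2_set (\<lambda>c. C $$ (r, i) * x i $ c) {..<d})"
      by (rule L2_set_sum_le[OF fin])
    also have "\<dots> = (\<Sum>i\<in>\<pi>. C $$ (r, i) * vec_l2 (x i))"
    proof (intro sum.cong refl)
      fix i assume i: "i \<in> \<pi>"
      have "dim_vec (x i) = d" using x[OF i] by (blast intro: carrier_vecD)
      thus "L2_set (\<lambda>c. C $$ (r, i) * x i $ c) {..<d} = C $$ (r, i) * vec_l2 (x i)"
        unfolding vec_l2_def by (simp only: L2_set_right_distrib[OF C[OF r i]])
    qed
    also have "\<dots> \<le> (\<Sum>i\<in>\<pi>. C $$ (r, i) * 1)"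
      by (intro sum_mono mult_left_mono C[OF r]) (blast dest: x)+
    finally show "L2_set (\<lambda>c. \<Sum>i\<in>\<pi>. C $$ (r, i) * x i $ c) {..<d} \<le> (\<Sum>i\<in>\<pi>. C $$ (r, i))" by simp
  qed (rule L2_set_nonneg)
  hence "(\<Sum>r<dim_row C. (L2_set (\<lambda>c. \<Sum>i\<in>\<pi>. C $$ (r, i) * x i $ c) {..<d})\<^sup>2)
      \<le> (\<Sum>r<dim_row C. (\<Sum>i\<in>\<pi>. C $$ (r, i))\<^sup>2)"
    by (intro sum_mono) simp
  moreover have "(frobenius (mat (dim_row C) d (\<lambda>(r, c). \<Sum>i\<in>\<pi>. C $$ (r, i) * x i $ c)))\<^sup>2
      = (\<Sum>r<dim_row C. (L2_set (\<lambda>c. \<Sum>i\<in>\<pi>. C $$ (r, i) * x i $ c) {..<d})\<^sup>2)"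
    unfolding frobenius_sq_eq
    by (intro sum.cong arg_cong[of _ _ "\<lambda>x. x\<^sup>2"] L2_set_cong) auto
  ultimately have "(frobenius (mat (dim_row C) d (\<lambda>(r, c). \<Sum>i\<in>\<pi>. C $$ (r, i) * x i $ c)))\<^sup>2
      \<le> (\<Sum>r<dim_row C. (\<Sum>i\<in>\<pi>. C $$ (r, i))\<^sup>2)" by simp
  also have "\<dots> = (\<Sum>r<dim_row C. \<Sum>i\<in>\<pi>. \<Sum>j\<in>\<pi>. C $$ (r, i) * C $$ (r, j))"
    by (simp add: power2_eq_square sum_product)
  also have "\<dots> = (\<Sum>i\<in>\<pi>. \<Sum>j\<in>\<pi>. \<Sum>r<dim_row C. C $$ (r, i) * C $$ (r, j))"
    by (subst sum.swap) (rule sum.cong[OF refl], rule sum.swap)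
  finally show ?thesis .
qed

text \<open>\<open>sens\<close> is a \<open>Sup\<close> of reals, so the set has to be nonempty and
  bounded above. The empty participation pattern supplies a nonnegative element, which also makes
  squaring monotone here.\<close>

lemma sens_sq_le:
  assumes "B \<ge> 0"
    and "\<And>\<pi> x. \<pi> \<in> participations (dim_col C) k b \<Longrightarrow>
      (\<And>i. i \<in> \<pi> \<Longrightarrow> x i \<in> carrier_vec d \<and> vec_l2 (x i) \<le> 1) \<Longrightarrow>
      (frobenius (mat (dim_row C) d (\<lambda>(r, c). \<Sum>i\<in>\<pi>. C $$ (r, i) * x i $ c)))\<^sup>2 \<le> B"
  shows "(sens d k b C)\<^sup>2 \<le> B"
proof -
  let ?T = "{frobenius (mat (dim_row C) d (\<lambda>(r, c). \<Sum>i\<in>\<pi>. C $$ (r, i) * x i $ c)) | \<pi> x.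
            \<pi> \<in> participations (dim_col C) k b \<and>
            (\<forall>i\<in>\<pi>. x i \<in> carrier_vec d \<and> vec_l2 (x i) \<le> 1)}"
  have le: "y \<le> sqrt B" if "y \<in> ?T" for y
    using that assms(2) by (auto intro: real_le_rsqrt)
  have "{} \<in> participations (dim_col C) k b" by (simp add: participations_def)
  hence "frobenius (mat (dim_row C) d (\<lambda>(r, c). \<Sum>i\<in>{}. C $$ (r, i) * (undefined i) $ c)) \<in> ?T" by blast
  then obtain y where y: "y \<in> ?T" "y \<ge> 0" by (auto simp: frobenius_def L2_set_nonneg)
  have "sens d k b C \<le> sqrt B"
    unfolding sens_def using y le by (intro cSup_least) blast+
  moreover have "0 \<le> sens d k b C"
    unfolding sens_def using y le by (intro order.trans[OF y(2)] cSup_upper) (auto simp: bdd_above_def)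
  ultimately have "(sens d k b C)\<^sup>2 \<le> (sqrt B)\<^sup>2" by (rule power_mono)
  thus ?thesis using assms(1) by simp
qed

text \<open>Two numbers with the same quotient by \<open>b\<close> differ by less than
  \<open>b\<close>. Hence, on each side of \<open>i\<close>, at most one participation lies at a
  distance in [s b, (s + 1) b).\<close>

lemma spaced_div_inj:
  fixes i :: nat
  assumes sep: "\<forall>i\<in>\<pi>. \<forall>j\<in>\<pi>. i \<noteq> j \<longrightarrow> int b \<le> \<bar>int i - int j\<bar>" and b: "b \<ge> 1"
  shows "inj_on (\<lambda>j. (j - i) div b) {j\<in>\<pi>. i < j}" and "inj_on (\<lambda>j. (i - j) div b) {j\<in>\<pi>. j < i}"
proof -
  have *: "x = y" if "x div b = y div b" "x \<noteq> y \<longrightarrow> int b \<le> \<bar>int x - int y\<bar>" for x y :: nat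
  proof (rule ccontr)
    assume "x \<noteq> y"
    have "x = b * (x div b) + x mod b" by simp
    moreover have "y = b * (x div b) + y mod b" unfolding that(1) by simp
    moreover have "x mod b < b" "y mod b < b" using b by simp_all
    ultimately have "\<bar>int x - int y\<bar> < int b" by linarith
    thus False using that(2) \<open>x \<noteq> y\<close> by simp
  qed
  show "inj_on (\<lambda>j. (j - i) div b) {j\<in>\<pi>. i < j}"
  proof (rule inj_onI)
    fix x y assume A: "x \<in> {j\<in>\<pi>. i < j}" "y \<in> {j\<in>\<pi>. i < j}" "(x - i) div b = (y - i) div b"
    have "x \<noteq> y \<longrightarrow> int b \<le> \<bar>int x - int y\<bar>" using sep A by blast
    moreover have xy: "i < x" "i < y" using A by auto
    moreover from xy have "int (x - i) - int (y - i) = int x - int y" by linarith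
    ultimately have "x - i \<noteq> y - i \<longrightarrow> int b \<le> \<bar>int (x - i) - int (y - i)\<bar>" by metis
    from *[OF A(3) this] show "x = y" using xy by linarith
  qed
  show "inj_on (\<lambda>j. (i - j) div b) {j\<in>\<pi>. j < i}"
  proof (rule inj_onI)
    fix x y assume A: "x \<in> {j\<in>\<pi>. j < i}" "y \<in> {j\<in>\<pi>. j < i}" "(i - x) div b = (i - y) div b"
    have "x \<noteq> y \<longrightarrow> int b \<le> \<bar>int x - int y\<bar>" using sep A by blast
    moreover have xy: "x < i" "y < i" using A by auto
    moreover from xy have "\<bar>int (i - x) - int (i - y)\<bar> = \<bar>int x - int y\<bar>" by linarith
    ultimately have "i - x \<noteq> i - y \<longrightarrow> int b \<le> \<bar>int (i - x) - int (i - y)\<bar>" by metis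
    from *[OF A(3) this] show "x = y" using xy by linarith
  qed
qed

lemma div_less_max_part:
  assumes "1 \<le> b" "m < n"
  shows "m div b < max_part n b"
proof -
  have "real (m div b) \<le> real m / real b" by (rule of_nat_div_le_of_nat)
  also have "\<dots> < real n / real b" using assms by (simp add: divide_strict_right_mono)
  also have "\<dots> \<le> real_of_int \<lceil>real n / real b\<rceil>" by linarith
  finally show ?thesis by (simp add: max_part_def) 
qed

text \<open>Each row of the Gram matrix consists of a diagonal entry and two sides, which accounts
  for the factor 2. On a side the distances fall into distinct blocks 1 \<le> s < k, and
  \<open>g s\<close> bounds the autocorrelation at every lag from s b on. There are at most
  \<open>k\<close> rows.\<close>

lemma sens_toeplitz_le:
  assumes f: "\<And>m. f m \<ge> 0" and b: "1 \<le> b" and k: "k = max_part n b"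
    and g: "\<And>m s. 1 \<le> s \<Longrightarrow> s * b \<le> m \<Longrightarrow> m < n \<Longrightarrow> (\<Sum>l<n. f l * f (l + m)) \<le> g s"
    and g0: "\<And>s. g s \<ge> 0"
  shows "(sens d k b (toeplitz n f))\<^sup>2 \<le> real k * ((\<Sum>l<n. (f l)\<^sup>2) + 2 * (\<Sum>s\<in>{1..<k}. g s))"
proof (rule sens_sq_le)
  show "0 \<le> real k * ((\<Sum>l<n. (f l)\<^sup>2) + 2 * (\<Sum>s\<in>{1..<k}. g s))"
    by (intro mult_nonneg_nonneg add_nonneg_nonneg sum_nonneg g0) auto
  fix \<pi> x assume pi: "\<pi> \<in> participations (dim_col (toeplitz n f)) k b"
    and x: "\<And>i. i \<in> \<pi> \<Longrightarrow> x i \<in> carrier_vec d \<and> vec_l2 (x i) \<le> 1"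
  define G where "G m = (\<Sum>l<n. f l * f (l + m))" for m
  define h where "h i j = (\<Sum>r<n. toeplitz n f $$ (r, i) * toeplitz n f $$ (r, j))" for i j
  have sub: "\<pi> \<subseteq> {..<n}" and card: "card \<pi> \<le> k"
    and sep: "\<forall>i\<in>\<pi>. \<forall>j\<in>\<pi>. i \<noteq> j \<longrightarrow> int b \<le> \<bar>int i - int j\<bar>"
    using pi by (auto simp: participations_def)
  have fin: "finite \<pi>" using sub by (rule finite_subset) simp
  have h_le: "h i j \<le> G (j - i)" if "i \<le> j" "j < n" for i j
  proof -
    have "h i j = (\<Sum>r<n. (if i \<le> r then f (r - i) else 0) * (if j \<le> r then f (r - j) else 0))"
      using that unfolding h_def by (intro sum.cong) auto
    also have "\<dots> = (\<Sum>r\<in>{j..<n}. f (r - i) * f (r - j))"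
      using that by (intro sum.mono_neutral_cong_right) auto
    also have "\<dots> = (\<Sum>l<n - j. f l * f (l + (j - i)))"
      by (rule sum.reindex_bij_witness[of _ "\<lambda>l. l + j" "\<lambda>r. r - j"])
        (use that in \<open>auto simp: mult.commute\<close>)
    \<comment> \<open>The matrix boundary cuts the correlation off at n - j terms; filling up to
      \<open>n\<close> with nonnegative terms leaves a quantity that depends on the lag
      alone.\<close>
    also have "\<dots> \<le> G (j - i)" unfolding G_def by (intro sum_mono2) (auto simp: f)
    finally show ?thesis .
  qed
  have h_sym: "h i j = h j i" for i j unfolding h_def by (simp add: mult.commute)
  have off: "(\<Sum>j\<in>J. h i j) \<le> (\<Sum>s\<in>{1..<k}. g s)"
    if J: "J \<subseteq> \<pi>" and inj: "inj_on (\<lambda>j. \<delta> j div b) J"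
      and \<delta>: "\<And>j. j \<in> J \<Longrightarrow> b \<le> \<delta> j \<and> \<delta> j < n \<and> h i j \<le> G (\<delta> j)" for i J \<delta>
  proof -
    have "(\<Sum>j\<in>J. h i j) \<le> (\<Sum>j\<in>J. g (\<delta> j div b))"
    proof (rule sum_mono)
      fix j assume j: "j \<in> J"
      have "h i j \<le> G (\<delta> j)" using \<delta>[OF j] by simp
      also have "\<dots> \<le> g (\<delta> j div b)"
        unfolding G_def using \<delta>[OF j] b by (intro g) (auto simp: div_greater_zero_iff Suc_le_eq)
      finally show "h i j \<le> g (\<delta> j div b)" .
    qed
    also have "\<dots> = (\<Sum>s\<in>(\<lambda>j. \<delta> j div b) ` J. g s)" by (simp add: sum.reindex[OF inj])
    also have "\<dots> \<le> (\<Sum>s\<in>{1..<k}. g s)"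
    proof (rule sum_mono2)
      show "(\<lambda>j. \<delta> j div b) ` J \<subseteq> {1..<k}"
      proof safe
        fix j assume j: "j \<in> J"
        have "0 < \<delta> j div b" using \<delta>[OF j] b by (simp add: div_greater_zero_iff)
        moreover have "\<delta> j div b < k" unfolding k using \<delta>[OF j] by (intro div_less_max_part b) simp
        ultimately show "\<delta> j div b \<in> {1..<k}" by simp
      qed
    qed (auto simp: g0)
    finally show ?thesis .
  qed
  have row: "(\<Sum>j\<in>\<pi>. h i j) \<le> G 0 + 2 * (\<Sum>s\<in>{1..<k}. g s)" if i: "i \<in> \<pi>" for i
  proof -
    have "(\<Sum>j\<in>{j\<in>\<pi>. i < j}. h i j) \<le> (\<Sum>s\<in>{1..<k}. g s)"
    proof (intro off[of _ "\<lambda>j. j - i"] spaced_div_inj[OF sep b] conjI)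
      fix j assume j: "j \<in> {j\<in>\<pi>. i < j}"
      hence "i < j" "j < n" using sub by auto
      moreover have "int b \<le> \<bar>int i - int j\<bar>" using bspec[OF bspec[OF sep i], of j] j by force
      ultimately have ij: "i < j" "j < n" "int b \<le> int j - int i" by linarith+
      thus "b \<le> j - i" "j - i < n" by linarith+
      show "h i j \<le> G (j - i)" using ij by (intro h_le) auto
    qed auto
    moreover have "(\<Sum>j\<in>{j\<in>\<pi>. j < i}. h i j) \<le> (\<Sum>s\<in>{1..<k}. g s)"
    proof (intro off[of _ "\<lambda>j. i - j"] spaced_div_inj[OF sep b] conjI)
      fix j assume j: "j \<in> {j\<in>\<pi>. j < i}"
      hence "j < i" "i < n" using sub i by auto
      moreover have "int b \<le> \<bar>int i - int j\<bar>" using bspec[OF bspec[OF sep i], of j] j by force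
      ultimately have ij: "j < i" "i < n" "int b \<le> int i - int j" by linarith+
      thus "b \<le> i - j" "i - j < n" by linarith+
      show "h i j \<le> G (i - j)" using ij unfolding h_sym[of i j] by (intro h_le) auto
    qed auto
    moreover have "h i i \<le> G 0" using h_le[of i i] i sub by auto
    moreover have "(\<Sum>j\<in>\<pi>. h i j) = h i i + ((\<Sum>j\<in>{j\<in>\<pi>. i < j}. h i j) + (\<Sum>j\<in>{j\<in>\<pi>. j < i}. h i j))"
    proof -
      have "\<pi> = insert i ({j\<in>\<pi>. i < j} \<union> {j\<in>\<pi>. j < i})" using i by auto
      also have "(\<Sum>j\<in>\<dots>. h i j) = h i i + (\<Sum>j\<in>{j\<in>\<pi>. i < j} \<union> {j\<in>\<pi>. j < i}. h i j)"
        using fin by (intro sum.insert) auto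
      also have "(\<Sum>j\<in>{j\<in>\<pi>. i < j} \<union> {j\<in>\<pi>. j < i}. h i j) =
          (\<Sum>j\<in>{j\<in>\<pi>. i < j}. h i j) + (\<Sum>j\<in>{j\<in>\<pi>. j < i}. h i j)"
        using fin by (intro sum.union_disjoint) auto
      finally show ?thesis .
    qed
    ultimately show ?thesis by linarith
  qed
  have "(frobenius (mat (dim_row (toeplitz n f)) d (\<lambda>(r, c). \<Sum>i\<in>\<pi>. toeplitz n f $$ (r, i) * x i $ c)))\<^sup>2
      \<le> (\<Sum>i\<in>\<pi>. \<Sum>j\<in>\<pi>. h i j)"
  proof -
    have "0 \<le> toeplitz n f $$ (r, i)" if "r < dim_row (toeplitz n f)" "i \<in> \<pi>" for r i
      using that sub f by (auto simp: subset_iff)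
    from frobenius_participation_le[of "toeplitz n f" \<pi> x d, OF this fin x]
    show ?thesis by (simp add: h_def)
  qed
  also have "\<dots> \<le> (\<Sum>i\<in>\<pi>. G 0 + 2 * (\<Sum>s\<in>{1..<k}. g s))" by (intro sum_mono row)
  also have "\<dots> = real (card \<pi>) * (G 0 + 2 * (\<Sum>s\<in>{1..<k}. g s))" by simp
  also have "\<dots> \<le> real k * (G 0 + 2 * (\<Sum>s\<in>{1..<k}. g s))"
    unfolding G_def using card by (intro mult_right_mono add_nonneg_nonneg mult_nonneg_nonneg sum_nonneg g0 f) auto
  also have "G 0 = (\<Sum>l<n. (f l)\<^sup>2)" by (simp add: G_def power2_eq_square)
  finally show "(frobenius (mat (dim_row (toeplitz n f)) d (\<lambda>(r, c). \<Sum>i\<in>\<pi>. toeplitz n f $$ (r, i) * x i $ c)))\<^sup>2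
      \<le> real k * ((\<Sum>l<n. (f l)\<^sup>2) + 2 * (\<Sum>s\<in>{1..<k}. g s))" .
qed

section \<open>Concentration\<close>

text \<open>The tilt takes back half of the Gaussian exponent, so the integrand is
  \<open>sqrt 2\<close> times the density with standard deviation \<open>sqrt 2 * s\<close>.\<close>

lemma nn_integral_exp_sq_normal_density:
  assumes s: "s > 0"
  shows "(\<integral>\<^sup>+ y. ennreal (normal_density 0 s y) * ennreal (exp (y\<^sup>2 / (4 * s\<^sup>2))) \<partial>lborel) = ennreal (sqrt 2)"
proof -
  have eq: "normal_density 0 s y * exp (y\<^sup>2 / (4 * s\<^sup>2)) = sqrt 2 * normal_density 0 (sqrt 2 * s) y" for y
  proof -
    have "exp (- y\<^sup>2 / (2 * s\<^sup>2)) * exp (y\<^sup>2 / (4 * s\<^sup>2)) = exp (- y\<^sup>2 / (2 * (sqrt 2 * s)\<^sup>2))"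
      using s unfolding exp_add[symmetric] by (simp add: power_mult_distrib field_simps)
    moreover have "sqrt (2 * pi * (sqrt 2 * s)\<^sup>2) = sqrt 2 * sqrt (2 * pi * s\<^sup>2)"
      by (simp add: power_mult_distrib real_sqrt_mult)
    ultimately show ?thesis
      by (simp add: normal_density_def)
  qed
  have "(\<integral>\<^sup>+ y. ennreal (normal_density 0 s y) * ennreal (exp (y\<^sup>2 / (4 * s\<^sup>2))) \<partial>lborel) =
      (\<integral>\<^sup>+ y. ennreal (sqrt 2) * ennreal (normal_density 0 (sqrt 2 * s) y) \<partial>lborel)"
    by (intro nn_integral_cong) (simp add: ennreal_mult'[symmetric] eq normal_density_nonneg)
  also have "\<dots> = ennreal (sqrt 2) * (\<integral>\<^sup>+ y. ennreal (normal_density 0 (sqrt 2 * s) y) \<partial>lborel)"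
    by (intro nn_integral_cmult) simp
  also have "(\<integral>\<^sup>+ y. ennreal (normal_density 0 (sqrt 2 * s) y) \<partial>lborel) = 1"
    using s by (subst nn_integral_eq_integral) (auto simp: normal_density_nonneg)
  finally show ?thesis by simp
qed

lemma index_mult_mat_sum:
  fixes B :: "real mat"
  assumes "B \<in> carrier_mat m n" "A \<in> carrier_mat n d" "i < m" "j < d"
  shows "(B * A) $$ (i, j) = (\<Sum>l\<in>{0..<n}. B $$ (i, l) * A $$ (l, j))"
  using assms by (simp add: scalar_prod_def)

lemma index_row_minus_vec:
  fixes R :: "real mat"
  assumes "R \<in> carrier_mat n d" "\<mu> \<in> carrier_vec d" "i < n" "j < d"
  shows "(row R i - \<mu>) $ j = R $$ (i, j) - \<mu> $ j"
  using assms by auto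

context prob_space
begin

text \<open>An exponential Markov bound. Exceeding the threshold makes the sum of Y_j^2 / (4 s^2) at
  least d + ln (1 / \<beta>). Its exponential has expectation (sqrt 2)^d, and sqrt 2 \<le> e lets
  the summand d pay for this power.\<close>

lemma gaussian_vector_tail:
  fixes Y :: "nat \<Rightarrow> 'a \<Rightarrow> real"
  assumes ind: "indep_vars (\<lambda>_. borel) Y {..<d}"
    and normal: "\<And>j. j < d \<Longrightarrow> distributed M lborel (Y j) (normal_density 0 s)"
    and s: "s > 0" and \<beta>: "0 < \<beta>" "\<beta> < 1"
  shows "prob {\<omega>\<in>space M. L2_set (\<lambda>j. Y j \<omega>) {..<d} > 2 * s * (sqrt d + sqrt (ln (1 / \<beta>)))} \<le> \<beta>"
proof -
  \<comment> \<open>Values in \<open>ennreal\<close> spare integrability arguments, both for the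
    product rule under independence and for Markov's inequality.\<close>
  define U where "U \<omega> = (\<Prod>j<d. ennreal (exp ((Y j \<omega>)\<^sup>2 / (4 * s\<^sup>2))))" for \<omega>
  define L where "L = ln (1 / \<beta>)"
  have L: "L > 0" using \<beta> by (simp add: L_def)
  have Y[measurable]: "j < d \<Longrightarrow> Y j \<in> borel_measurable M" for j
    using ind by (auto simp: indep_vars_def)
  have U[measurable]: "U \<in> borel_measurable M" unfolding U_def by measurable
  have "(\<integral>\<^sup>+\<omega>. U \<omega> \<partial>M) = (\<Prod>j<d. \<integral>\<^sup>+\<omega>. ennreal (exp ((Y j \<omega>)\<^sup>2 / (4 * s\<^sup>2))) \<partial>M)"
    unfolding U_def
    by (intro indep_vars_nn_integral indep_vars_compose2[OF ind]) auto
  also have "\<dots> = (\<Prod>j<d. ennreal (sqrt 2))"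
  proof (intro prod.cong refl)
    fix j assume "j \<in> {..<d}"
    hence "distributed M lborel (Y j) (normal_density 0 s)" using normal by simp
    from distributed_nn_integral[OF this, of "\<lambda>y. ennreal (exp (y\<^sup>2 / (4 * s\<^sup>2)))"]
    show "(\<integral>\<^sup>+\<omega>. ennreal (exp ((Y j \<omega>)\<^sup>2 / (4 * s\<^sup>2))) \<partial>M) = ennreal (sqrt 2)"
      using nn_integral_exp_sq_normal_density[OF s] by simp
  qed
  also have "\<dots> = ennreal (sqrt 2 ^ d)" by (simp add: ennreal_power)
  finally have int: "(\<integral>\<^sup>+\<omega>. U \<omega> \<partial>M) = ennreal (sqrt 2 ^ d)" .
  have "{\<omega>\<in>space M. L2_set (\<lambda>j. Y j \<omega>) {..<d} > 2 * s * (sqrt d + sqrt L)}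
      \<subseteq> {\<omega>\<in>space M. 1 \<le> ennreal (\<beta> / sqrt 2 ^ d) * U \<omega>}"
  proof safe
    fix \<omega> assume *: "2 * s * (sqrt d + sqrt L) < L2_set (\<lambda>j. Y j \<omega>) {..<d}"
    have "4 * s\<^sup>2 * (d + L) \<le> 4 * s\<^sup>2 * (sqrt d + sqrt L)\<^sup>2"
      using L by (intro mult_left_mono) (auto simp: power2_sum)
    also have "\<dots> = (2 * s * (sqrt d + sqrt L))\<^sup>2" by (simp add: power_mult_distrib)
    also have "\<dots> \<le> (L2_set (\<lambda>j. Y j \<omega>) {..<d})\<^sup>2"
      using * s L by (intro power_mono) auto
    also have "\<dots> = (\<Sum>j<d. (Y j \<omega>)\<^sup>2)" by (simp add: L2_set_def sum_nonneg)
    finally have "d + L \<le> (\<Sum>j<d. (Y j \<omega>)\<^sup>2 / (4 * s\<^sup>2))"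
      using s by (simp add: sum_divide_distrib[symmetric] field_simps)
    hence "exp (d + L) \<le> exp (\<Sum>j<d. (Y j \<omega>)\<^sup>2 / (4 * s\<^sup>2))" by simp
    also have "\<dots> = (\<Prod>j<d. exp ((Y j \<omega>)\<^sup>2 / (4 * s\<^sup>2)))" by (simp add: exp_sum)
    finally have 1: "exp (d + L) \<le> (\<Prod>j<d. exp ((Y j \<omega>)\<^sup>2 / (4 * s\<^sup>2)))" .
    have U_eq: "U \<omega> = ennreal (\<Prod>j<d. exp ((Y j \<omega>)\<^sup>2 / (4 * s\<^sup>2)))"
      unfolding U_def by (simp add: prod_ennreal)
    have "sqrt 2 \<le> exp (1 :: real)" 
      using exp_ge_add_one_self[of "1 :: real"] sqrt_le_D[of 2 2] by (smt (verit) real_sqrt_le_iff real_sqrt_four)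
    hence "sqrt 2 ^ d \<le> exp (1 :: real) ^ d" by (intro power_mono) auto
    also have "\<dots> = exp (real d)" by (simp add: exp_of_nat_mult[symmetric])
    finally have "sqrt 2 ^ d \<le> exp (real d)" .
    hence "1 \<le> \<beta> / sqrt 2 ^ d * exp (d + L)"
      using \<beta> by (simp add: exp_add L_def field_simps)
    also have "\<dots> \<le> \<beta> / sqrt 2 ^ d * (\<Prod>j<d. exp ((Y j \<omega>)\<^sup>2 / (4 * s\<^sup>2)))"
      using \<beta> 1 by (intro mult_left_mono) auto
    finally have "ennreal 1 \<le> ennreal (\<beta> / sqrt 2 ^ d * (\<Prod>j<d. exp ((Y j \<omega>)\<^sup>2 / (4 * s\<^sup>2))))"
      by (rule ennreal_leI)
    also have "\<dots> = ennreal (\<beta> / sqrt 2 ^ d) * U \<omega>"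
      unfolding U_eq using \<beta> by (intro ennreal_mult prod_nonneg) auto
    finally show "1 \<le> ennreal (\<beta> / sqrt 2 ^ d) * U \<omega>" by simp
  qed
  hence "emeasure M {\<omega>\<in>space M. L2_set (\<lambda>j. Y j \<omega>) {..<d} > 2 * s * (sqrt d + sqrt L)}
      \<le> emeasure M {\<omega>\<in>space M. 1 \<le> ennreal (\<beta> / sqrt 2 ^ d) * U \<omega>}"
    by (intro emeasure_mono) auto
  also have "\<dots> \<le> ennreal (\<beta> / sqrt 2 ^ d) * (\<integral>\<^sup>+\<omega>. U \<omega> * indicator (space M) \<omega> \<partial>M)"
    by (intro nn_integral_Markov_inequality) auto
  also have "(\<integral>\<^sup>+\<omega>. U \<omega> * indicator (space M) \<omega> \<partial>M) = ennreal (sqrt 2 ^ d)"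
    unfolding int[symmetric] by (intro nn_integral_cong) auto
  also have "ennreal (\<beta> / sqrt 2 ^ d) * ennreal (sqrt 2 ^ d) = ennreal \<beta>"
    using \<beta> by (simp add: ennreal_mult[symmetric])
  finally show ?thesis
    using \<beta> unfolding L_def by (simp add: emeasure_eq_measure)
qed

text \<open>With 1 / 0 = 0, \<open>normal_density 0 0\<close> vanishes identically and has mass 0
  instead of 1. Thus the distributional assumption on the noise itself forces a positive
  variance.\<close>

lemma distributed_normal_pos:
  assumes "distributed M lborel X (normal_density 0 s)" and "s \<ge> 0"
  shows "s > 0"
proof (rule ccontr)
  assume "\<not> s > 0"
  hence "s = 0" using assms by simp
  hence "normal_density 0 s = (\<lambda>_. 0)" by (auto simp: normal_density_def)
  with distributed_nn_integral[OF assms(1), of "\<lambda>_. 1"] emeasure_space_1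
  show False by (simp add: zero_ennreal_def[symmetric])
qed

text \<open>Different columns use disjoint sets of entries of \<open>Z\<close>, so the weighted
  column sums are independent centred normals, each of variance v times the sum of the squared
  weights.\<close>

lemma gaussian_noise_tail:
  assumes Z: "gaussian_entries M n d v Z" and t: "1 \<le> t" "t \<le> n" and d: "1 \<le> d" and v: "v \<ge> 0"
    and w: "\<And>l. l < t \<Longrightarrow> w l > 0" and \<beta>: "0 < \<beta>" "\<beta> < 1"
  shows "prob {\<omega>\<in>space M. L2_set (\<lambda>j. \<Sum>l<t. w l * Z \<omega> $$ (l, j)) {..<d} >
    2 * sqrt (v * (\<Sum>l<t. (w l)\<^sup>2)) * (sqrt d + sqrt (ln (1 / \<beta>)))} \<le> \<beta>"
proof (rule gaussian_vector_tail[OF _ _ _ \<beta>])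
  have ind: "indep_vars (\<lambda>_. borel) (\<lambda>ij \<omega>. Z \<omega> $$ ij) ({..<n} \<times> {..<d})"
    and nd: "\<And>ij. ij \<in> {..<n} \<times> {..<d} \<Longrightarrow> distributed M lborel (\<lambda>\<omega>. Z \<omega> $$ ij) (normal_density 0 (sqrt v))"
    using Z by (auto simp: gaussian_entries_def)
  have sv: "sqrt v > 0" using nd[of "(0, 0)"] t d v by (intro distributed_normal_pos) auto
  show "sqrt (v * (\<Sum>l<t. (w l)\<^sup>2)) > 0"
    using sv t w[of 0] by (auto intro!: mult_pos_pos sum_pos2[of _ 0])
  have "indep_vars (\<lambda>j. PiM ({..<t} \<times> {j}) (\<lambda>_. borel)) (\<lambda>j \<omega>. restrict (\<lambda>ij. Z \<omega> $$ ij) ({..<t} \<times> {j})) {..<d}"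
    using t by (intro indep_vars_restrict[OF ind]) (auto simp: disjoint_family_on_def)
  hence "indep_vars (\<lambda>_. borel) (\<lambda>j \<omega>. (\<lambda>f. \<Sum>l<t. w l * f (l, j)) (restrict (\<lambda>ij. Z \<omega> $$ ij) ({..<t} \<times> {j}))) {..<d}"
    by (rule indep_vars_compose2) (auto intro!: borel_measurable_sum borel_measurable_times measurable_component_singleton)
  thus "indep_vars (\<lambda>_. borel) (\<lambda>j \<omega>. \<Sum>l<t. w l * Z \<omega> $$ (l, j)) {..<d}"
    by simp
  fix j assume j: "j < d"
  have "distributed M lborel (\<lambda>\<omega>. \<Sum>l<t. w l * Z \<omega> $$ (l, j))
    (normal_density (\<Sum>l<t. 0) (sqrt (\<Sum>l<t. (w l * sqrt v)\<^sup>2)))"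
  proof (rule sum_indep_normal)
    have "indep_vars (\<lambda>l. PiM {(l, j)} (\<lambda>_. borel)) (\<lambda>l \<omega>. restrict (\<lambda>ij. Z \<omega> $$ ij) {(l, j)}) {..<t}"
      using t j by (intro indep_vars_restrict[OF ind]) (auto simp: disjoint_family_on_def)
    hence "indep_vars (\<lambda>_. borel) (\<lambda>l \<omega>. (\<lambda>f. w l * f (l, j)) (restrict (\<lambda>ij. Z \<omega> $$ ij) {(l, j)})) {..<t}"
      by (rule indep_vars_compose2) (auto intro!: borel_measurable_times measurable_component_singleton)
    thus "indep_vars (\<lambda>_. borel) (\<lambda>l \<omega>. w l * Z \<omega> $$ (l, j)) {..<t}" by simp
    fix l assume l: "l \<in> {..<t}"
    show "0 < w l * sqrt v" using l w sv by simp
    show "distributed M lborel (\<lambda>\<omega>. w l * Z \<omega> $$ (l, j)) (normal_density 0 (w l * sqrt v))"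
      using normal_density_affine[OF nd[of "(l, j)"] sv, of "w l" 0] w[of l] l t j by simp
  qed (use t in \<open>auto simp: lessThan_empty_iff\<close>)
  thus "distributed M lborel (\<lambda>\<omega>. \<Sum>l<t. w l * Z \<omega> $$ (l, j)) (normal_density 0 (sqrt (v * (\<Sum>l<t. (w l)\<^sup>2))))"
    using v by (simp add: power_mult_distrib sum_distrib_left mult.commute)
qed

text \<open>Coordinates within a row may be dependent; independence is available along a fixed
  column, which is what Hoeffding's inequality needs.\<close>

lemma bernoulli_rows_entry:
  assumes X: "bernoulli_rows M n d \<mu> X" and j: "j < d"
  shows "indep_vars (\<lambda>_. borel) (\<lambda>i \<omega>. X \<omega> $$ (i, j)) {..<n}"
proof -
  have "indep_vars (\<lambda>_. PiM {..<d} (\<lambda>_. borel :: real measure)) (\<lambda>i \<omega>. \<lambda>j\<in>{..<d}. X \<omega> $$ (i, j)) {..<n}"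
    using X by (simp add: bernoulli_rows_def Let_def)
  hence "indep_vars (\<lambda>_. borel) (\<lambda>i \<omega>. (\<lambda>f. f j) (\<lambda>j\<in>{..<d}. X \<omega> $$ (i, j))) {..<n}"
    by (rule indep_vars_compose2) (use j in \<open>auto intro!: measurable_component_singleton\<close>)
  thus ?thesis using j by simp
qed

text \<open>Hoeffding for each coordinate with failure probability \<beta> / d, then a union bound.
  Since \<beta> < 1 / 2 gives d / \<beta> \<ge> 2, ln (2 d / \<beta>) is at most 2 ln (d / \<beta>),
  and this 2 cancels the one in Hoeffding's exponent: the sampling term has constant 1.\<close>

lemma bernoulli_mean_tail:
  assumes X: "bernoulli_rows M n d \<mu> X" and t: "1 \<le> t" "t \<le> n" and d: "1 \<le> d"
    and \<beta>: "0 < \<beta>" "\<beta> < 1 / 2"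
  shows "prob {\<omega>\<in>space M. L2_set (\<lambda>j. (\<Sum>i<t. X \<omega> $$ (i, j)) / t - \<mu> $ j) {..<d} >
    sampling_rate d 1 \<beta> t} \<le> \<beta>"
proof -
  \<comment> \<open>The solution of 2 exp (- 2 t s^2) = \<beta> / d.\<close>
  define s where "s = sqrt (ln (2 * d / \<beta>) / (2 * t))"
  have "2 * \<beta> \<le> real d * 2" using d \<beta> by simp
  hence ln_pos: "ln (2 * d / \<beta>) > 0" using \<beta> d by (intro ln_gt_zero) (auto simp: field_simps)
  have s: "s > 0" unfolding s_def using ln_pos t by simp
  have s2: "2 * t * s\<^sup>2 = ln (2 * d / \<beta>)" using ln_pos t by (simp add: s_def)
  have meas[measurable]: "i < n \<Longrightarrow> j < d \<Longrightarrow> (\<lambda>\<omega>. X \<omega> $$ (i, j)) \<in> borel_measurable M" for i j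
    using bernoulli_rows_entry[OF X, of j] by (auto simp: indep_vars_def)
  have ev[measurable]: "{\<omega>\<in>space M. \<bar>(\<Sum>i<t. X \<omega> $$ (i, j)) - t * \<mu> $ j\<bar> \<ge> t * s} \<in> events" if "j < d" for j
  proof -
    have "(\<lambda>\<omega>. \<Sum>i<t. X \<omega> $$ (i, j)) \<in> borel_measurable M"
      using that t by (intro borel_measurable_sum meas) auto
    thus ?thesis by measurable
  qed
  have tail: "prob {\<omega>\<in>space M. \<bar>(\<Sum>i<t. X \<omega> $$ (i, j)) - t * \<mu> $ j\<bar> \<ge> t * s} \<le> \<beta> / d" if j: "j < d" for j
  proof -
    have mean: "expectation (\<lambda>\<omega>. X \<omega> $$ (i, j)) = \<mu> $ j" if "i < n" for i
      using X j that by (simp add: bernoulli_rows_def Let_def)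
    interpret Hoeffding_ineq M "{..<t}" "\<lambda>i \<omega>. X \<omega> $$ (i, j)" "\<lambda>_. 0" "\<lambda>_. 1" "t * \<mu> $ j"
    proof unfold_locales
      show "indep_vars (\<lambda>_. borel) (\<lambda>i \<omega>. X \<omega> $$ (i, j)) {..<t}"
        using t by (intro indep_vars_subset[OF bernoulli_rows_entry[OF X j]]) auto
      show "AE \<omega> in M. X \<omega> $$ (i, j) \<in> {0..1}" if "i \<in> {..<t}" for i
      proof -
        have "AE \<omega> in M. \<forall>j<d. X \<omega> $$ (i, j) \<in> {0, 1}"
          using X that t by (simp add: bernoulli_rows_def Let_def)
        thus ?thesis by eventually_elim (use j in auto)
      qed
      have "(\<Sum>i<t. expectation (\<lambda>\<omega>. X \<omega> $$ (i, j))) = (\<Sum>i<t. \<mu> $ j)"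
        using t by (intro sum.cong mean) auto
      thus "t * \<mu> $ j \<equiv> \<Sum>i<t. expectation (\<lambda>\<omega>. X \<omega> $$ (i, j))" by simp
    qed auto
    have "prob {\<omega>\<in>space M. \<bar>(\<Sum>i<t. X \<omega> $$ (i, j)) - t * \<mu> $ j\<bar> \<ge> t * s} \<le>
        2 * exp (-2 * (t * s)\<^sup>2 / (\<Sum>i<t. (1 - 0)\<^sup>2))"
      using s t by (intro Hoeffding_ineq_abs_ge) auto
    also have "-2 * (t * s)\<^sup>2 / (\<Sum>i<t. (1 - 0)\<^sup>2) = - (2 * t * s\<^sup>2)"
      using t by (simp add: power_mult_distrib power2_eq_square)
    also have "2 * exp (- (2 * t * s\<^sup>2)) = \<beta> / d"
      unfolding s2 using \<beta> d by (simp add: exp_minus)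
    finally show ?thesis .
  qed
  have "{\<omega>\<in>space M. L2_set (\<lambda>j. (\<Sum>i<t. X \<omega> $$ (i, j)) / t - \<mu> $ j) {..<d} > sampling_rate d 1 \<beta> t}
      \<subseteq> (\<Union>j\<in>{..<d}. {\<omega>\<in>space M. \<bar>(\<Sum>i<t. X \<omega> $$ (i, j)) - t * \<mu> $ j\<bar> \<ge> t * s})"
  proof safe
    fix \<omega> assume \<omega>: "\<omega> \<in> space M"
      "sampling_rate d 1 \<beta> t < L2_set (\<lambda>j. (\<Sum>i<t. X \<omega> $$ (i, j)) / t - \<mu> $ j) {..<d}"
    have "\<exists>j<d. \<bar>(\<Sum>i<t. X \<omega> $$ (i, j)) - t * \<mu> $ j\<bar> \<ge> t * s"
    proof (rule ccontr)
      assume "\<not> ?thesis"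
      hence *: "\<bar>(\<Sum>i<t. X \<omega> $$ (i, j)) - t * \<mu> $ j\<bar> \<le> t * s" if "j < d" for j
        using that by (meson linear)
      have "((\<Sum>i<t. X \<omega> $$ (i, j)) / t - \<mu> $ j)\<^sup>2 \<le> s\<^sup>2" if "j < d" for j
      proof (rule iffD1[OF abs_le_square_iff])
        have "(\<Sum>i<t. X \<omega> $$ (i, j)) / t - \<mu> $ j = ((\<Sum>i<t. X \<omega> $$ (i, j)) - t * \<mu> $ j) / t"
          using t by (simp add: field_simps)
        thus "\<bar>(\<Sum>i<t. X \<omega> $$ (i, j)) / t - \<mu> $ j\<bar> \<le> \<bar>s\<bar>"
          using *[OF that] s t by (simp add: field_simps)
      qed
      hence "(\<Sum>j<d. ((\<Sum>i<t. X \<omega> $$ (i, j)) / t - \<mu> $ j)\<^sup>2) \<le> (\<Sum>j<d. s\<^sup>2)"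
        by (intro sum_mono) simp
      also have "\<dots> = d * (ln (2 * d / \<beta>) / (2 * t))" using s2 t by (simp add: field_simps)
      also have "\<dots> \<le> d * (2 * ln (d / \<beta>) / (2 * t))"
      proof (intro mult_left_mono divide_right_mono)
        have "2 \<le> d / \<beta>" using d \<beta> by (simp add: field_simps)
        hence "ln 2 \<le> ln (d / \<beta>)" by (intro ln_mono) auto
        moreover have "ln (2 * (d / \<beta>)) = ln 2 + ln (d / \<beta>)" using d \<beta> by (intro ln_mult_pos) auto
        ultimately show "ln (2 * d / \<beta>) \<le> 2 * ln (d / \<beta>)" by simp
      qed auto
      finally have "L2_set (\<lambda>j. (\<Sum>i<t. X \<omega> $$ (i, j)) / t - \<mu> $ j) {..<d} \<le> sampling_rate d 1 \<beta> t"
        unfolding L2_set_def sampling_rate_def by (intro real_sqrt_le_mono) (simp add: field_simps)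
      thus False using \<omega>(2) by simp
    qed
    thus "\<omega> \<in> (\<Union>j\<in>{..<d}. {\<omega>\<in>space M. \<bar>(\<Sum>i<t. X \<omega> $$ (i, j)) - t * \<mu> $ j\<bar> \<ge> t * s})"
      using \<omega>(1) by auto
  qed
  hence "prob {\<omega>\<in>space M. L2_set (\<lambda>j. (\<Sum>i<t. X \<omega> $$ (i, j)) / t - \<mu> $ j) {..<d} > sampling_rate d 1 \<beta> t}
      \<le> prob (\<Union>j\<in>{..<d}. {\<omega>\<in>space M. \<bar>(\<Sum>i<t. X \<omega> $$ (i, j)) - t * \<mu> $ j\<bar> \<ge> t * s})"
    by (intro finite_measure_mono sets.finite_UN) (auto intro: ev)
  also have "\<dots> \<le> (\<Sum>j<d. prob {\<omega>\<in>space M. \<bar>(\<Sum>i<t. X \<omega> $$ (i, j)) - t * \<mu> $ j\<bar> \<ge> t * s})"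
    by (intro finite_measure_subadditive_finite) (auto intro: ev)
  also have "\<dots> \<le> (\<Sum>j<d. \<beta> / d)" by (intro sum_mono tail) simp
  also have "\<dots> = \<beta>" using d by simp
  finally show ?thesis .
qed

text \<open>\<open>P\<close> is the sampling error, \<open>N\<close> the noise; each exceeds its
  bound with probability at most \<beta>. The number \<open>\<tau>\<close> stands for any upper
  bound on sensitivity times the norm of the row of \<open>B\<close>.\<close>

lemma mechanism_error_within:
  assumes X: "bernoulli_rows M n d \<mu> X"
    and Z: "gaussian_entries M n d (noise_variance d k b 1 \<epsilon> \<delta> C) Z"
    and C: "C \<in> carrier_mat n n" "C' \<in> carrier_mat n n" "mat_inv C = C'" "C' * C = 1\<^sub>m n"
    and w: "\<And>j. j < n \<Longrightarrow> (running_mean_mat n * C') $$ (t - 1, j) = (if j < t then w j else 0)"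
    and w_pos: "\<And>j. j < t \<Longrightarrow> w j > 0"
    and \<tau>: "(sens d k b C)\<^sup>2 * (\<Sum>j<t. (w j)\<^sup>2) \<le> \<tau>\<^sup>2" "0 \<le> \<tau>"
    and t: "1 \<le> t" "t \<le> n" and d: "1 \<le> d" and \<beta>: "0 < \<beta>" "\<beta> < 1"
    and \<epsilon>: "0 < \<epsilon>" and \<delta>: "0 < \<delta>" "\<delta> < 1"
    and r: "sampling_rate d 1 \<beta> t +
      2 * (noise_sigma \<epsilon> \<delta> * sqrt d * \<tau>) * (sqrt d + sqrt (ln (1 / \<beta>))) \<le> r"
  shows "1 - 2 * \<beta> \<le> prob {\<omega> \<in> space M. vec_l2 (private_mean n C (X \<omega>) (Z \<omega>) t - \<mu>) \<le> r}"
proof (cases "\<beta> < 1 / 2")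
  \<comment> \<open>For \<beta> \<ge> 1 / 2 the claimed probability is not positive; the sampling
    bound is only available below 1 / 2.\<close>
  case False
  hence "1 - 2 * \<beta> \<le> 0" by simp
  thus ?thesis using measure_nonneg by (rule order.trans)
next
  case True
  define v where "v = noise_variance d k b 1 \<epsilon> \<delta> C"
  define P where "P \<omega> j = (\<Sum>i<t. X \<omega> $$ (i, j)) / t - \<mu> $ j" for \<omega> j
  define N where "N \<omega> j = (\<Sum>l<t. w l * Z \<omega> $$ (l, j))" for \<omega> j
  let ?q = "sqrt d + sqrt (ln (1 / \<beta>))"
  define b1 where "b1 = sampling_rate d 1 \<beta> t"
  define b2 where "b2 = 2 * sqrt (v * (\<Sum>l<t. (w l)\<^sup>2)) * ?q"
  have v: "v \<ge> 0" by (simp add: v_def noise_variance_def)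
  have eq: "vec_l2 (private_mean n C (X \<omega>) (Z \<omega>) t - \<mu>) = L2_set (\<lambda>j. P \<omega> j + N \<omega> j) {..<d}"
    if \<omega>: "\<omega> \<in> space M" for \<omega>
  proof -
    let ?A = "running_mean_mat n"
    have A: "?A \<in> carrier_mat n n" by (simp add: running_mean_mat_def)
    have Xc: "X \<omega> \<in> carrier_mat n d" and mu: "\<mu> \<in> carrier_vec d"
      using X \<omega> by (auto simp: bernoulli_rows_def Let_def)
    have Zc: "Z \<omega> \<in> carrier_mat n d" using Z \<omega> by (auto simp: gaussian_entries_def)
    have AC: "?A * C' \<in> carrier_mat n n" using A C by simp
    have "mf_mechanism (?A * mat_inv C) C (X \<omega>) (Z \<omega>) = ?A * C' * (C * X \<omega>) + ?A * C' * Z \<omega>"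
      unfolding mf_mechanism_def C(3) using AC C(1) Xc Zc by (intro mult_add_distrib_mat) auto
    also have "?A * C' * (C * X \<omega>) = ?A * C' * C * X \<omega>"
      using AC C(1) Xc by (metis assoc_mult_mat)
    also have "?A * C' * C = ?A * (C' * C)"
      using A C(1,2) by (metis assoc_mult_mat)
    also have "\<dots> = ?A" unfolding C(4) using A by simp
    finally have mf: "mf_mechanism (?A * mat_inv C) C (X \<omega>) (Z \<omega>) = ?A * X \<omega> + ?A * C' * Z \<omega>" .
    have idx: "(private_mean n C (X \<omega>) (Z \<omega>) t - \<mu>) $ j = P \<omega> j + N \<omega> j" if j: "j < d" for j
    proof -
      have t1: "t - 1 < n" using t by simp
      have 1: "(?A * X \<omega>) $$ (t - 1, j) = (\<Sum>i<t. X \<omega> $$ (i, j)) / t"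
      proof -
        have "(?A * X \<omega>) $$ (t - 1, j) = (\<Sum>i\<in>{0..<n}. ?A $$ (t - 1, i) * X \<omega> $$ (i, j))"
          by (rule index_mult_mat_sum[OF A Xc t1 j])
        also have "\<dots> = (\<Sum>i\<in>{0..<n}. (if i \<le> t - 1 then 1 / real t else 0) * X \<omega> $$ (i, j))"
          using t t1 by (intro sum.cong) (auto simp: running_mean_mat_def)
        also have "\<dots> = (\<Sum>i<t. 1 / real t * X \<omega> $$ (i, j))"
          using t by (intro sum.mono_neutral_cong_right) auto
        finally show ?thesis by (simp add: sum_divide_distrib)
      qed
      have 2: "(?A * C' * Z \<omega>) $$ (t - 1, j) = N \<omega> j"
      proof -
        have "(?A * C' * Z \<omega>) $$ (t - 1, j) = (\<Sum>l\<in>{0..<n}. (?A * C') $$ (t - 1, l) * Z \<omega> $$ (l, j))"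
          by (rule index_mult_mat_sum[OF AC Zc t1 j])
        also have "\<dots> = (\<Sum>l<t. w l * Z \<omega> $$ (l, j))"
          using t w by (intro sum.mono_neutral_cong_right) auto
        finally show ?thesis by (simp add: N_def)
      qed
      have "(private_mean n C (X \<omega>) (Z \<omega>) t - \<mu>) $ j = (?A * X \<omega> + ?A * C' * Z \<omega>) $$ (t - 1, j) - \<mu> $ j"
        unfolding private_mean_def mf
        by (rule index_row_minus_vec[OF _ mu t1 j]) (use A AC Xc Zc in auto)
      also have "\<dots> = (?A * X \<omega>) $$ (t - 1, j) + (?A * C' * Z \<omega>) $$ (t - 1, j) - \<mu> $ j"
        using t1 AC Zc j by (subst index_add_mat(1)) auto
      finally show ?thesis unfolding 1 2 by (simp add: P_def)
    qed
    have "dim_vec (private_mean n C (X \<omega>) (Z \<omega>) t - \<mu>) = d" using mu by simp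
    thus ?thesis unfolding vec_l2_def using idx by (intro L2_set_cong) auto
  qed
  have measX: "i < n \<Longrightarrow> j < d \<Longrightarrow> (\<lambda>\<omega>. X \<omega> $$ (i, j)) \<in> borel_measurable M" for i j
    using bernoulli_rows_entry[OF X, of j] by (auto simp: indep_vars_def)
  have measZ: "i < n \<Longrightarrow> j < d \<Longrightarrow> (\<lambda>\<omega>. Z \<omega> $$ (i, j)) \<in> borel_measurable M" for i j
    using Z by (auto simp: gaussian_entries_def indep_vars_def)
  have P[measurable]: "j < d \<Longrightarrow> (\<lambda>\<omega>. P \<omega> j) \<in> borel_measurable M" for j
    unfolding P_def using t by (intro borel_measurable_diff borel_measurable_divide borel_measurable_sum measX) auto
  have N[measurable]: "j < d \<Longrightarrow> (\<lambda>\<omega>. N \<omega> j) \<in> borel_measurable M" for j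
    unfolding N_def using t by (intro borel_measurable_sum borel_measurable_times measZ) auto
  have L2[measurable]: "(\<lambda>\<omega>. L2_set (f \<omega>) {..<d}) \<in> borel_measurable M"
    if "\<And>j. j < d \<Longrightarrow> (\<lambda>\<omega>. f \<omega> j) \<in> borel_measurable M" for f :: "'a \<Rightarrow> nat \<Rightarrow> real"
    unfolding L2_set_def using that by measurable
  have mP: "(\<lambda>\<omega>. L2_set (P \<omega>) {..<d}) \<in> borel_measurable M" by (rule L2) (rule P)
  have mN: "(\<lambda>\<omega>. L2_set (N \<omega>) {..<d}) \<in> borel_measurable M" by (rule L2) (rule N)
  have mPN: "(\<lambda>\<omega>. L2_set (\<lambda>j. P \<omega> j + N \<omega> j) {..<d}) \<in> borel_measurable M"
    by (rule L2) (intro borel_measurable_add P N)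
  let ?E1 = "{\<omega>\<in>space M. L2_set (P \<omega>) {..<d} > b1}"
  let ?E2 = "{\<omega>\<in>space M. L2_set (N \<omega>) {..<d} > b2}"
  let ?G = "{\<omega>\<in>space M. vec_l2 (private_mean n C (X \<omega>) (Z \<omega>) t - \<mu>) \<le> r}"
  have E1: "?E1 \<in> events" and E2: "?E2 \<in> events" using mP mN by measurable
  \<comment> \<open>A non-measurable set would get measure 0, so the target event must be shown
    measurable; this is visible once the error is written through \<open>P\<close> and
    \<open>N\<close>.\<close>
  have G_eq: "?G = {\<omega>\<in>space M. L2_set (\<lambda>j. P \<omega> j + N \<omega> j) {..<d} \<le> r}" using eq by auto
  have G: "?G \<in> events" unfolding G_eq using mPN by measurable
  have p1: "prob ?E1 \<le> \<beta>" unfolding P_def b1_def by (rule bernoulli_mean_tail[OF X t d \<beta>(1) True])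
  have p2: "prob ?E2 \<le> \<beta>" unfolding N_def b2_def
    by (rule gaussian_noise_tail[OF Z[folded v_def] t d v w_pos \<beta>])
  have sig: "noise_sigma \<epsilon> \<delta> \<ge> 0" unfolding noise_sigma_def using \<epsilon> \<delta> by (simp add: field_simps)
  have "v * (\<Sum>l<t. (w l)\<^sup>2) = (noise_sigma \<epsilon> \<delta>)\<^sup>2 * d * ((sens d k b C)\<^sup>2 * (\<Sum>l<t. (w l)\<^sup>2))"
    by (simp add: v_def noise_variance_def)
  also have "\<dots> \<le> (noise_sigma \<epsilon> \<delta>)\<^sup>2 * d * \<tau>\<^sup>2" by (intro mult_left_mono \<tau>) auto
  also have "\<dots> = (noise_sigma \<epsilon> \<delta> * sqrt d * \<tau>)\<^sup>2" by (simp add: power_mult_distrib)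
  finally have "sqrt (v * (\<Sum>l<t. (w l)\<^sup>2)) \<le> noise_sigma \<epsilon> \<delta> * sqrt d * \<tau>"
    using sig \<tau> by (intro real_le_lsqrt) auto
  hence "b2 \<le> 2 * (noise_sigma \<epsilon> \<delta> * sqrt d * \<tau>) * ?q"
    unfolding b2_def using \<beta> by (intro mult_right_mono mult_left_mono) (auto simp: field_simps)
  hence b12: "b1 + b2 \<le> r" using r unfolding b1_def by linarith
  have "space M - (?E1 \<union> ?E2) \<subseteq> ?G"
  proof
    fix \<omega> assume \<omega>: "\<omega> \<in> space M - (?E1 \<union> ?E2)"
    have "L2_set (\<lambda>j. P \<omega> j + N \<omega> j) {..<d} \<le> L2_set (P \<omega>) {..<d} + L2_set (N \<omega>) {..<d}"
      by (rule L2_set_triangle_ineq)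
    also have "\<dots> \<le> r" using \<omega> b12 by auto
    finally show "\<omega> \<in> ?G" using \<omega> unfolding G_eq by auto
  qed
  hence "prob (space M - (?E1 \<union> ?E2)) \<le> prob ?G" using G by (rule finite_measure_mono)
  moreover have "prob (space M - (?E1 \<union> ?E2)) = 1 - prob (?E1 \<union> ?E2)"
    using E1 E2 by (intro prob_compl) auto
  moreover have "prob (?E1 \<union> ?E2) \<le> prob ?E1 + prob ?E2" using E1 E2 by (intro measure_Un_le)
  ultimately show ?thesis using p1 p2 by linarith
qed

end

context prob_space
begin

text \<open>Separates shape from constants: \<open>q\<close> carries the dependence on n, k and t,
  \<open>K\<close> is numerical, and \<open>\<kappa>\<close> compares the noise scale with sqrt (ln
  (1 / \<delta>)) / \<epsilon>. The factor 2 in 2 \<kappa> K comes from the Gaussian tail, and 1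
  \<le> c covers the sampling term.\<close>

lemma mechanism_error_rate:
  assumes X: "bernoulli_rows M n d \<mu> X"
    and Z: "gaussian_entries M n d (noise_variance d k b 1 \<epsilon> \<delta> C) Z"
    and C: "C \<in> carrier_mat n n" "C' \<in> carrier_mat n n" "mat_inv C = C'" "C' * C = 1\<^sub>m n"
    and w: "\<And>j. j < n \<Longrightarrow> (running_mean_mat n * C') $$ (t - 1, j) = (if j < t then u (t - 1 - j) / real t else 0)"
    and u_pos: "\<And>m. m < t \<Longrightarrow> u m > 0"
    and q: "(sens d k b C)\<^sup>2 * ((\<Sum>m<t. (u m)\<^sup>2) / (real t)\<^sup>2) \<le> (K * q)\<^sup>2" "0 \<le> q" "0 \<le> K"
    and t: "1 \<le> t" "t \<le> n" and d: "1 \<le> d" and \<beta>: "0 < \<beta>" "\<beta> < 1"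
    and \<epsilon>: "0 < \<epsilon>" and \<delta>: "0 < \<delta>" "\<delta> < 1"
    and \<kappa>: "noise_sigma \<epsilon> \<delta> \<le> \<kappa> * (sqrt (ln (1 / \<delta>)) / \<epsilon>)" and c: "1 \<le> c" "2 * \<kappa> * K \<le> c"
    and r: "r = sampling_rate d 1 \<beta> t +
      q * sqrt d * (sqrt (ln (1 / \<delta>)) / \<epsilon>) * (sqrt d + sqrt (ln (1 / \<beta>)))"
  shows "1 - 2 * \<beta> \<le> prob {\<omega> \<in> space M. vec_l2 (private_mean n C (X \<omega>) (Z \<omega>) t - \<mu>) \<le> c * r}"
proof (rule mechanism_error_within[OF X Z C w])
  have "(\<Sum>j<t. (u (t - 1 - j) / real t)\<^sup>2) = (\<Sum>m<t. (u m)\<^sup>2) / (real t)\<^sup>2"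
    using sum.nat_diff_reindex[of "\<lambda>m. (u m)\<^sup>2" t]
    by (simp add: power_divide sum_divide_distrib[symmetric])
  thus "(sens d k b C)\<^sup>2 * (\<Sum>j<t. (u (t - 1 - j) / real t)\<^sup>2) \<le> (K * q)\<^sup>2" using q by simp
  show "0 \<le> K * q" using q by simp
  show "u (t - 1 - j) / real t > 0" if "j < t" for j using u_pos[of "t - 1 - j"] that by simp
  let ?e = "sqrt (ln (1 / \<delta>)) / \<epsilon>"
  let ?h = "sqrt d + sqrt (ln (1 / \<beta>))"
  have e: "?e \<ge> 0" using \<delta> \<epsilon> by simp
  have h: "?h \<ge> 0" using \<beta> by simp
  have s: "sampling_rate d 1 \<beta> t \<ge> 0"
  proof -
    have "1 \<le> d / \<beta>" using d \<beta> by (simp add: field_simps)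
    thus ?thesis by (simp add: sampling_rate_def)
  qed
  have "2 * (noise_sigma \<epsilon> \<delta> * sqrt d * (K * q)) * ?h \<le> 2 * (\<kappa> * ?e * sqrt d * (K * q)) * ?h"
    using q h by (intro mult_right_mono mult_left_mono \<kappa>) auto
  also have "\<dots> = (2 * \<kappa> * K) * (q * sqrt d * ?e * ?h)" by (simp only: mult_ac)
  also have "\<dots> \<le> c * (q * sqrt d * ?e * ?h)"
    using q e h by (intro mult_right_mono c mult_nonneg_nonneg) auto
  finally have "2 * (noise_sigma \<epsilon> \<delta> * sqrt d * (K * q)) * ?h \<le> c * (q * sqrt d * ?e * ?h)" .
  moreover have "1 * sampling_rate d 1 \<beta> t \<le> c * sampling_rate d 1 \<beta> t"
    by (intro mult_right_mono c s)
  ultimately show "sampling_rate d 1 \<beta> t + 2 * (noise_sigma \<epsilon> \<delta> * sqrt d * (K * q)) * ?h \<le> c * r"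
    unfolding r by (simp add: distrib_left)
qed (use t d \<beta> \<epsilon> \<delta> in auto)

end

section \<open>Toeplitz matrices of a log-convex sequence: inverses, mechanism weights, banded
  sensitivity\<close>

context kaluza_seq
begin

lemma mat_inv_toeplitz_a: "mat_inv (toeplitz n a) = toeplitz n c"
  using mat_inv_toeplitz[OF a_inverse, of n] by (simp add: c_def Abs_fps_inverse)

lemma toeplitz_c_mult_a: "toeplitz n c * toeplitz n a = 1\<^sub>m n"
  using toeplitz_mult[of n "inverse (Abs_fps a)" "Abs_fps a"] a_inverse
  by (simp add: c_def Abs_fps_inverse toeplitz_one mult.commute)

lemma running_mean_mult_toeplitz_c:
  "1 \<le> t \<Longrightarrow> t \<le> n \<Longrightarrow> j < n \<Longrightarrow>
    (running_mean_mat n * toeplitz n c) $$ (t - 1, j) = (if j < t then S (t - 1 - j) / real t else 0)"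
  by (subst running_mean_mult_toeplitz) (auto simp: S_def)

lemma banded_inverse_toeplitz_a:
  "1 \<le> p \<Longrightarrow> banded_inverse p (toeplitz n a) = toeplitz n (banded p)"
  using banded_inverse_toeplitz[of "Abs_fps a" p n] by (simp add: banded_def Abs_fps_inverse a_0)

lemma mat_inv_toeplitz_banded:
  assumes "1 \<le> p"
  shows "mat_inv (toeplitz n (banded p)) = toeplitz n (\<lambda>i. if i < p then c i else 0)"
    and "toeplitz n (\<lambda>i. if i < p then c i else 0) * toeplitz n (banded p) = 1\<^sub>m n"
proof -
  have eq: "(\<lambda>i. if i < p then c i else 0) = fps_nth (fps_cutoff p (inverse (Abs_fps a)))"
    by (auto simp: c_def)
  show "mat_inv (toeplitz n (banded p)) = toeplitz n (\<lambda>i. if i < p then c i else 0)"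
    unfolding eq banded_def by (rule mat_inv_toeplitz[OF banded_inverse[OF assms]])
  show "toeplitz n (\<lambda>i. if i < p then c i else 0) * toeplitz n (banded p) = 1\<^sub>m n"
    unfolding eq banded_def toeplitz_mult using banded_inverse[OF assms]
    by (simp add: mult.commute toeplitz_one)
qed

lemma running_mean_mult_toeplitz_cutoff:
  "1 \<le> p \<Longrightarrow> 1 \<le> t \<Longrightarrow> t \<le> n \<Longrightarrow> j < n \<Longrightarrow>
    (running_mean_mat n * toeplitz n (\<lambda>i. if i < p then c i else 0)) $$ (t - 1, j) =
      (if j < t then S (min (t - 1 - j) (p - 1)) / real t else 0)"
  by (subst running_mean_mult_toeplitz) (auto simp: cutoff_partial_sum)

text \<open>The off-diagonal part is free of \<open>k\<close>: at lags from s b on, the shifted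
  factor is at most \<theta>^(s - 1) a b, the other factor has total mass at most 1 / S (p - 1), and
  the geometric series over s adds another 1 / S (p - 1).\<close>

lemma sens_banded_le:
  assumes p: "1 \<le> p" "p \<le> b" and k: "k = max_part n b" and S: "S (p - 1) > 0"
  shows "(sens d k b (toeplitz n (banded p)))\<^sup>2 \<le>
    real k * ((\<Sum>l<n. (banded p l)\<^sup>2) + 2 * (a b / (S (p - 1))\<^sup>2))"
proof -
  define \<theta> where "\<theta> = 1 - S (p - 1)"
  have \<theta>: "0 \<le> \<theta>" "\<theta> < 1" using S S_le_1[of "p - 1"] by (auto simp: \<theta>_def)
  have b: "1 \<le> b" using p by simp
  \<comment> \<open>The exponent is s - 1 since at lag \<open>b\<close> itself only the bound
    \<open>a b\<close> is available.\<close>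
  define g where "g s = \<theta> ^ (s - 1) * a b / S (p - 1)" for s
  have g0: "g s \<ge> 0" for s unfolding g_def using \<theta> S less_imp_le[OF a_pos[of b]] by simp
  have g: "(\<Sum>l<n. banded p l * banded p (l + m)) \<le> g s" if s: "1 \<le> s" "s * b \<le> m" "m < n" for m s
  proof -
    have "(\<Sum>l<n. banded p l * banded p (l + m)) \<le> (\<Sum>l<n. banded p l * (\<theta> ^ (s - 1) * a b))"
    proof (intro sum_mono mult_left_mono banded_nonneg[OF p(1)])
      fix l
      have "(s - 1) * b + b = s * b" using s by (cases s) auto
      thus "banded p (l + m) \<le> \<theta> ^ (s - 1) * a b"
        unfolding \<theta>_def using s by (intro banded_decay p) auto
    qed
    also have "\<dots> = (\<theta> ^ (s - 1) * a b) * (\<Sum>l<n. banded p l)" by (simp only: sum_distrib_left mult.commute[of _ "\<theta> ^ (s - 1) * a b"])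
    also have "\<dots> \<le> (\<theta> ^ (s - 1) * a b) * (1 / S (p - 1))"
    proof (intro mult_left_mono)
      have "(\<Sum>l<n. banded p l) \<le> (\<Sum>l\<le>n. banded p l)"
        by (intro sum_mono2) (auto intro: banded_nonneg[OF p(1)])
      also have "\<dots> \<le> 1 / S (p - 1)"
        using banded_sum[OF p(1), of n] S by (simp add: field_simps)
      finally show "(\<Sum>l<n. banded p l) \<le> 1 / S (p - 1)" .
    qed (use \<theta> less_imp_le[OF a_pos[of b]] in auto)
    finally show ?thesis by (simp add: g_def)
  qed
  have "(\<Sum>s\<in>{1..<k}. g s) \<le> a b / (S (p - 1))\<^sup>2"
  proof -
    have "(\<Sum>s\<in>{1..<k}. g s) = (\<Sum>s<k - 1. \<theta> ^ s) * (a b / S (p - 1))"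
      unfolding sum_distrib_right
      by (rule sum.reindex_bij_witness[of _ Suc "\<lambda>s. s - 1"]) (auto simp: g_def)
    also have "\<dots> \<le> 1 / S (p - 1) * (a b / S (p - 1))"
    proof (rule mult_right_mono)
      have "(\<Sum>s<k - 1. \<theta> ^ s) = (1 - \<theta> ^ (k - 1)) / (1 - \<theta>)" using \<theta> by (subst sum_gp_strict) auto
      also have "\<dots> \<le> 1 / S (p - 1)" using \<theta> S by (auto simp: \<theta>_def intro!: divide_right_mono)
      finally show "(\<Sum>s<k - 1. \<theta> ^ s) \<le> 1 / S (p - 1)" .
    qed (use S less_imp_le[OF a_pos[of b]] in simp)
    finally show ?thesis by (simp add: power2_eq_square)
  qed
  hence "real k * ((\<Sum>l<n. (banded p l)\<^sup>2) + 2 * (\<Sum>s\<in>{1..<k}. g s)) \<le>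
    real k * ((\<Sum>l<n. (banded p l)\<^sup>2) + 2 * (a b / (S (p - 1))\<^sup>2))"
    by (intro mult_left_mono) auto
  moreover have "(sens d k b (toeplitz n (banded p)))\<^sup>2 \<le>
    real k * ((\<Sum>l<n. (banded p l)\<^sup>2) + 2 * (\<Sum>s\<in>{1..<k}. g s))"
    by (rule sens_toeplitz_le[OF banded_nonneg[OF p(1)] b k]) (use g g0 in auto)
  ultimately show ?thesis by linarith
qed

end

section \<open>Elementary estimates\<close>

lemma harm_le_ln: "1 \<le> n \<Longrightarrow> harm n \<le> 1 + ln (real n)"
  using euler_mascheroni_sequence_decreasing[of 1 n] by (simp add: harm_expand)

lemma harm_le_3_ln: "2 \<le> n \<Longrightarrow> harm n \<le> 3 * ln (real n)"
proof -
  assume n: "2 \<le> n"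
  have "1 / 2 \<le> ln (2 :: real)" using ln2_ge_two_thirds by simp
  also have "\<dots> \<le> ln (real n)" using n by simp
  finally show ?thesis using harm_le_ln[of n] n by simp
qed

text \<open>With y = (n / m)^(1/4), harm n - harm m \<le> ln (n / m) = 4 ln y \<le> 4 y. As harm m
  and y are at least 1, harm n \<le> 5 y harm m, hence 25 after squaring.\<close>

lemma harm_le_quarter_power:
  assumes "1 \<le> m" "m \<le> n"
  shows "(harm n)\<^sup>2 \<le> 25 * (harm m)\<^sup>2 * sqrt (real n / real m)"
proof -
  define y where "y = sqrt (sqrt (real n / real m))"
  have y: "y \<ge> 1" using assms by (simp add: y_def)
  have y2: "y\<^sup>2 = sqrt (real n / real m)" by (simp add: y_def)
  have "y ^ 4 = (y\<^sup>2)\<^sup>2" by simp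
  hence y4: "y ^ 4 = real n / real m" unfolding y2 by simp
  have "harm n \<le> harm m + (ln (real n) - ln (real m))"
    using euler_mascheroni_sequence_decreasing[of m n] assms by simp
  also have "ln (real n) - ln (real m) = ln (y ^ 4)" using assms unfolding y4 by (simp add: ln_div)
  also have "\<dots> = 4 * ln y" using y by (simp add: ln_realpow)
  also have "\<dots> \<le> 4 * y" using ln_le_minus_one[of y] y by simp
  finally have *: "harm n \<le> harm m + 4 * y" by simp
  have "1 \<le> (harm m :: real)" using harm_mono[of 1 m, where 'a = real] assms by (simp add: harm_expand)
  hence "harm m + 4 * y \<le> 5 * harm m * y"
  proof -
    assume h: "1 \<le> (harm m :: real)"
    have "1 * y \<le> harm m * y" using h y by (intro mult_right_mono) auto
    moreover have "harm m * 1 \<le> harm m * y" using h y by (intro mult_left_mono) auto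
    ultimately show ?thesis by linarith
  qed
  with * have "harm n \<le> 5 * harm m * y" by linarith
  hence "(harm n)\<^sup>2 \<le> (5 * harm m * y)\<^sup>2" by (intro power_mono harm_nonneg)
  thus ?thesis by (simp add: power_mult_distrib y2)
qed

lemma sum_inverse_sqrt_le: "(\<Sum>i<n. 1 / sqrt (real (Suc i))) \<le> 2 * sqrt (real n)"
proof (induction n)
  case (Suc n)
  \<comment> \<open>A telescoping bound, obtained by rationalising the difference of roots.\<close>
  have "1 / sqrt (real (Suc n)) \<le> 2 * (sqrt (real (Suc n)) - sqrt (real n))"
  proof -
    have "1 = (sqrt (real (Suc n)) - sqrt (real n)) * (sqrt (real (Suc n)) + sqrt (real n))"
      by (simp add: algebra_simps)
    also have "\<dots> \<le> (sqrt (real (Suc n)) - sqrt (real n)) * (2 * sqrt (real (Suc n)))"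
      by (intro mult_left_mono) auto
    finally show ?thesis by (simp add: field_simps)
  qed
  thus ?case using Suc.IH by simp
qed simp

text \<open>Each term is at most 25 sqrt (n / (m + 1)) times the last one, and the sum of 1 / sqrt
  (m + 1) is at most 2 sqrt n; together 50.\<close>

lemma sum_inverse_harm_sq_le:
  assumes "1 \<le> n"
  shows "(\<Sum>m<n. 1 / (harm (Suc m))\<^sup>2) \<le> 50 * real n / (harm n)\<^sup>2"
proof -
  have hp: "0 < (harm n :: real)" using assms by (intro harm_pos) simp
  have aux: "1 / x\<^sup>2 \<le> 25 / y\<^sup>2 * z" if "y\<^sup>2 \<le> 25 * x\<^sup>2 * z" "x > 0" "y > 0" for x y z :: real
    using that by (simp add: field_simps)
  have "1 / (harm (Suc m))\<^sup>2 \<le> 25 / (harm n)\<^sup>2 * (sqrt (real n) * (1 / sqrt (real (Suc m))))" if "m < n" for m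
  proof -
    have h: "0 < (harm (Suc m) :: real)" by (intro harm_pos) simp
    have "(harm n)\<^sup>2 \<le> 25 * (harm (Suc m))\<^sup>2 * sqrt (real n / real (Suc m))"
      using that by (intro harm_le_quarter_power) auto
    hence "1 / (harm (Suc m))\<^sup>2 \<le> 25 / (harm n)\<^sup>2 * sqrt (real n / real (Suc m))"
      using h hp by (intro aux)
    thus ?thesis by (simp add: real_sqrt_divide)
  qed
  hence "(\<Sum>m<n. 1 / (harm (Suc m))\<^sup>2) \<le> (\<Sum>m<n. 25 / (harm n)\<^sup>2 * (sqrt (real n) * (1 / sqrt (real (Suc m)))))"
    by (intro sum_mono) simp
  also have "\<dots> = 25 / (harm n)\<^sup>2 * (sqrt (real n) * (\<Sum>m<n. 1 / sqrt (real (Suc m))))"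
    by (simp only: sum_distrib_left)
  also have "\<dots> \<le> 25 / (harm n)\<^sup>2 * (sqrt (real n) * (2 * sqrt (real n)))"
    by (intro mult_left_mono sum_inverse_sqrt_le) auto
  finally show ?thesis by simp
qed

lemma sum_inverse_sq_le: "(\<Sum>i<n. (1 / real (Suc i))\<^sup>2) \<le> 2"
proof -
  \<comment> \<open>The term 1 / (m + 1) is subtracted to make the induction go through.\<close>
  have "(\<Sum>i<Suc m. (1 / real (Suc i))\<^sup>2) \<le> 2 - 1 / real (Suc m)" for m
  proof (induction m)
    case (Suc m)
    have "(1 / real (Suc (Suc m)))\<^sup>2 \<le> 1 / real (Suc m) - 1 / real (Suc (Suc m))"
    proof -
      have "1 / real (Suc m) - 1 / real (Suc (Suc m)) = 1 / (real (Suc m) * real (Suc (Suc m)))"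
        by (simp add: field_simps)
      moreover have "1 / (real (Suc (Suc m)) * real (Suc (Suc m))) \<le> 1 / (real (Suc m) * real (Suc (Suc m)))"
        by (intro frac_le mult_right_mono) auto
      ultimately show ?thesis by (simp add: power2_eq_square)
    qed
    thus ?case using Suc.IH by simp
  qed simp
  from this[of n] have "(\<Sum>i<Suc n. (1 / real (Suc i))\<^sup>2) \<le> 2"
    by (rule order.trans) simp
  moreover have "(\<Sum>i<n. (1 / real (Suc i))\<^sup>2) \<le> (\<Sum>i<Suc n. (1 / real (Suc i))\<^sup>2)"
    by (intro sum_mono2) auto
  ultimately show ?thesis by linarith
qed

lemma sum_inverse_Suc_eq_harm: "(\<Sum>i<n. 1 / real (Suc i)) = harm n"
  by (simp add: harm_altdef inverse_eq_divide)

text \<open>Rounding up at most doubles n / b \<ge> 1, so \<open>b\<close> and n / k agree up to a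
  factor 2.\<close>

lemma max_part_bounds:
  assumes "1 \<le> b" "b \<le> n" and k: "k = max_part n b"
  shows "1 \<le> k" and "real n / real b \<le> real k" and "real b \<le> 2 * (real n / real k)"
proof -
  have q: "real n / real b \<ge> 1" using assms by simp
  have kr: "real k = real_of_int \<lceil>real n / real b\<rceil>"
    using q unfolding k max_part_def by (simp add: of_nat_nat)
  show k1: "real n / real b \<le> real k" unfolding kr by linarith
  with q show k0: "1 \<le> k" by linarith
  have "real k \<le> 2 * (real n / real b)" using q unfolding kr by linarith
  thus "real b \<le> 2 * (real n / real k)" using assms k0 by (simp add: field_simps)
qed

lemma sum_squares_le_square_sum:
  fixes x y :: real
  assumes "0 \<le> x" "0 \<le> y"
  shows "x + y \<le> (sqrt x + sqrt y)\<^sup>2"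
  using assms by (simp add: power2_sum)

section \<open>The harmonic sequence\<close>

definition harmonic_seq :: "nat \<Rightarrow> real" where
  "harmonic_seq m = 1 / real (Suc m)"

interpretation D: kaluza_seq harmonic_seq
proof
  fix i m :: nat assume im: "i \<le> m"
  have "real (Suc (Suc m)) * real (Suc i) \<le> real (Suc (Suc i)) * real (Suc m)"
    using im by (simp add: algebra_simps)
  thus "harmonic_seq (Suc i) * harmonic_seq m \<le> harmonic_seq (Suc m) * harmonic_seq i"
    unfolding harmonic_seq_def times_divide_times_eq mult_1 by (intro divide_left_mono) auto
qed (auto simp: harmonic_seq_def intro: divide_left_mono)

lemma D_Toep_eq: "D_Toep n = toeplitz n harmonic_seq"
  by (rule eq_matI) (auto simp: D_Toep_def harmonic_seq_def)

lemma D_S_upper: "D.S m \<le> 1 / harm (Suc m)"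
  using D.S_upper[of m] harm_pos[of "Suc m", where 'a = real] sum_inverse_Suc_eq_harm[of "Suc m"]
  unfolding lessThan_Suc_atMost harmonic_seq_def by (simp add: field_simps)

lemma D_S_lower: "1 / 2 \<le> D.S m * harm (2 * Suc m)"
proof -
  \<comment> \<open>The choice l = 2 m in \<open>D.S_lower\<close> makes the first part exactly 1 /
    2.\<close>
  have "real (Suc m) * harmonic_seq (Suc (2 * m)) = 1 / 2"
    by (simp add: harmonic_seq_def field_simps)
  moreover have "(\<Sum>i\<le>2 * m. harmonic_seq i) \<le> harm (2 * Suc m)"
    unfolding harmonic_seq_def lessThan_Suc_atMost[symmetric] sum_inverse_Suc_eq_harm
    by (intro harm_mono) simp
  hence "D.S m * (\<Sum>i\<le>2 * m. harmonic_seq i) \<le> D.S m * harm (2 * Suc m)"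
    by (intro mult_left_mono D.S_nonneg)
  ultimately show ?thesis using D.S_lower[of m "2 * m"] by linarith
qed

lemma D_S_pos: "D.S m > 0"
  using D_S_lower[of m] D.S_nonneg[of m] by (cases "D.S m = 0") auto

lemma sum_harmonic_seq_sq: "(\<Sum>l<n. (harmonic_seq l)\<^sup>2) \<le> 2"
  unfolding harmonic_seq_def by (rule sum_inverse_sq_le)

lemma sum_D_S_sq:
  assumes "1 \<le> t"
  shows "(\<Sum>m<t. (D.S m)\<^sup>2) \<le> 50 * real t / (harm t)\<^sup>2"
proof -
  have "(\<Sum>m<t. (D.S m)\<^sup>2) \<le> (\<Sum>m<t. (1 / harm (Suc m))\<^sup>2)"
    by (intro sum_mono power_mono D_S_upper D.S_nonneg)
  also have "\<dots> \<le> 50 * real t / (harm t)\<^sup>2"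
    using sum_inverse_harm_sq_le[OF assms] by (simp add: power_divide)
  finally show ?thesis .
qed

text \<open>The shifted factor is replaced by 1 / m; the remaining \<open>harm n\<close> becomes the
  factor ln n of the rate.\<close>

lemma harmonic_seq_correlation_le:
  assumes "1 \<le> m"
  shows "(\<Sum>l<n. harmonic_seq l * harmonic_seq (l + m)) \<le> harm n / real m"
proof -
  have "harmonic_seq l * harmonic_seq (l + m) \<le> 1 / real (Suc l) * (1 / real m)" for l
    unfolding harmonic_seq_def using assms by (intro mult_left_mono divide_left_mono) auto
  hence "(\<Sum>l<n. harmonic_seq l * harmonic_seq (l + m)) \<le> (\<Sum>l<n. 1 / real (Suc l) * (1 / real m))"
    by (intro sum_mono)
  also have "\<dots> = harm n / real m"
    unfolding sum_distrib_right[symmetric] sum_inverse_Suc_eq_harm by simp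
  finally show ?thesis .
qed

text \<open>The diagonal gives the summand sqrt k. The lags s b contribute harm n / (s b), whose sum
  over s is a second harmonic number; 18 is 2 * 3 * 3, with a 3 from each passage from
  \<open>harm\<close> to ln.\<close>

lemma sens_D_Toep_le:
  assumes b: "1 \<le> b" "b \<le> n" and k: "k = max_part n b" and n: "2 \<le> n"
  shows "(sens d k b (toeplitz n harmonic_seq))\<^sup>2 \<le>
    18 * (sqrt k + k / sqrt n * sqrt (ln k * ln n))\<^sup>2"
proof -
  note kb = max_part_bounds[OF b k]
  have k1: "1 \<le> k" by (rule kb)
  define g where "g s = harm n / (real s * real b)" for s
  have "(sens d k b (toeplitz n harmonic_seq))\<^sup>2 \<le>
      real k * ((\<Sum>l<n. (harmonic_seq l)\<^sup>2) + 2 * (\<Sum>s\<in>{1..<k}. g s))"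
  proof (rule sens_toeplitz_le[OF less_imp_le[OF D.a_pos] b(1) k])
    fix m s :: nat assume s: "1 \<le> s" "s * b \<le> m"
    have "1 * 1 \<le> s * b" using s b by (intro mult_le_mono)
    hence m: "1 \<le> m" using s by linarith
    have "real (s * b) \<le> real m" using s by (simp only: of_nat_le_iff)
    hence "harm n / real m \<le> harm n / (real s * real b)"
      using s b m by (intro divide_left_mono harm_nonneg) auto
    with harmonic_seq_correlation_le[OF m, of n] show "(\<Sum>l<n. harmonic_seq l * harmonic_seq (l + m)) \<le> g s"
      unfolding g_def by linarith
  qed (simp add: g_def harm_nonneg)
  also have "(\<Sum>s\<in>{1..<k}. g s) = harm n * harm (k - 1) / real b"
  proof -
    have "(\<Sum>s\<in>{1..<k}. g s) = (\<Sum>i<k - 1. 1 / real (Suc i) * (harm n / real b))"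
      by (rule sum.reindex_bij_witness[of _ Suc "\<lambda>s. s - 1"]) (auto simp: g_def)
    thus ?thesis unfolding sum_distrib_right[symmetric] sum_inverse_Suc_eq_harm by simp
  qed
  also have "real k * ((\<Sum>l<n. (harmonic_seq l)\<^sup>2) + 2 * (harm n * harm (k - 1) / real b)) \<le>
      real k * (2 + 2 * ((3 * ln n) * (3 * ln k) * (k / n)))"
  proof (intro mult_left_mono add_mono sum_harmonic_seq_sq)
    \<comment> \<open>The index k - 1 matters: for k = 1 both sides are 0, whereas harm 1 = 1 would
      exceed ln 1.\<close>
    have hk: "(harm (k - 1) :: real) \<le> 3 * ln k"
    proof (cases "k = 1")
      case False
      have "(harm (k - 1) :: real) \<le> harm k" by (intro harm_mono) simp
      also have "\<dots> \<le> 3 * ln k" using False k1 by (intro harm_le_3_ln) simp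
      finally show ?thesis .
    qed (simp add: harm_expand)
    have ib: "1 / real b \<le> k / n" using kb(2) b by (simp add: field_simps)
    have "harm n * harm (k - 1) * (1 / real b) \<le> (3 * ln n) * (3 * ln k) * (k / n)"
      using n k1 by (intro mult_mono hk ib harm_le_3_ln mult_nonneg_nonneg harm_nonneg) auto
    thus "harm n * harm (k - 1) / real b \<le> (3 * ln n) * (3 * ln k) * (k / n)" by simp
  qed auto
  also have "\<dots> = 2 * real k + 18 * (k * k / n * (ln k * ln n))" by (simp add: algebra_simps)
  also have "\<dots> \<le> 18 * (real k + k * k / n * (ln k * ln n))" by simp
  also have "real k + k * k / n * (ln k * ln n) \<le> (sqrt k + sqrt (k * k / n * (ln k * ln n)))\<^sup>2"
    using k1 n by (intro sum_squares_le_square_sum mult_nonneg_nonneg) auto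
  also have "sqrt (k * k / n * (ln k * ln n)) = k / sqrt n * sqrt (ln k * ln n)"
    by (simp add: real_sqrt_mult real_sqrt_divide)
  finally show ?thesis by simp
qed

text \<open>The constant is 18 * 50 = 900 = 30^2, from the sensitivity and from the row norm of
  \<open>B\<close>.\<close>

lemma error_D_Toep:
  assumes b: "1 \<le> b" "b \<le> n" and k: "k = max_part n b" and t: "2 \<le> t" "t \<le> n"
  defines "q \<equiv> 1 / (sqrt t * ln t) * (sqrt k + k / sqrt n * sqrt (ln k * ln n))"
  shows "(sens d k b (toeplitz n harmonic_seq))\<^sup>2 * ((\<Sum>m<t. (D.S m)\<^sup>2) / (real t)\<^sup>2) \<le> (30 * q)\<^sup>2"
proof -
  let ?x = "sqrt k + k / sqrt n * sqrt (ln k * ln n)"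
  have lt: "ln t > 0" using t by simp
  have "ln (real t) \<le> ln (real t + 1)" using t by simp
  also have "\<dots> \<le> harm t" by (rule ln_le_harm)
  finally have h: "(ln t)\<^sup>2 \<le> (harm t)\<^sup>2" using lt by (intro power_mono) auto
  have "(\<Sum>m<t. (D.S m)\<^sup>2) \<le> 50 * real t / (harm t)\<^sup>2" using t by (intro sum_D_S_sq) simp
  also have "\<dots> \<le> 50 * real t / (ln t)\<^sup>2"
    using h lt by (intro divide_left_mono mult_pos_pos) (auto intro: order.strict_trans2[of 0 "(ln t)\<^sup>2"])
  finally have "(sens d k b (toeplitz n harmonic_seq))\<^sup>2 * ((\<Sum>m<t. (D.S m)\<^sup>2) / (real t)\<^sup>2) \<le>
      (18 * ?x\<^sup>2) * ((50 * real t / (ln t)\<^sup>2) / (real t)\<^sup>2)"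
    using t by (intro mult_mono divide_right_mono sens_D_Toep_le b k) (auto intro!: divide_nonneg_nonneg sum_nonneg)
  also have "\<dots> = 900 * (?x\<^sup>2 / (real t * (ln t)\<^sup>2))"
    using t by (simp add: power2_eq_square[of "real t"])
  also have "?x\<^sup>2 / (real t * (ln t)\<^sup>2) = q\<^sup>2"
    unfolding q_def power_mult_distrib power_divide by simp
  also have "900 * q\<^sup>2 = (30 * q)\<^sup>2" by simp
  finally show ?thesis .
qed

text \<open>The squared sensitivity is of order k because (harm (2 b))^2 is at most a multiple of
  \<open>b\<close>, which bounds the correlation term. For the row norm, weights before
  \<open>b\<close> are those of the unbanded matrix and later ones are at most 1 / harm b. In total
  302 * 100 \<le> 200^2.\<close>

lemma error_D_Toep_banded:
  assumes b: "1 \<le> b" "b \<le> n" and k: "k = max_part n b" and t: "1 \<le> t" "t \<le> n"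
    and nk: "1 < real n / real k"
  defines "q \<equiv> sqrt k / sqrt (t * ln (n / k)) * (1 + sqrt (n / (real k * real t)))"
  shows "(sens d k b (toeplitz n (D.banded b)))\<^sup>2 *
    ((\<Sum>m<t. (D.S (min m (b - 1)))\<^sup>2) / (real t)\<^sup>2) \<le> (200 * q)\<^sup>2"
proof -
  note kb = max_part_bounds[OF b k]
  have k1: "1 \<le> k" by (rule kb)
  have hb: "0 < (harm b :: real)" using b by (intro harm_pos) simp
  have L: "ln (n / k) > 0" using nk by simp
  have "(sens d k b (toeplitz n (D.banded b)))\<^sup>2 \<le>
      real k * ((\<Sum>l<n. (D.banded b l)\<^sup>2) + 2 * (harmonic_seq b / (D.S (b - 1))\<^sup>2))"
    using b by (intro D.sens_banded_le k D_S_pos) auto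
  also have "\<dots> \<le> real k * (2 + 2 * 150)"
  proof (intro mult_left_mono add_mono)
    have "(\<Sum>l<n. (D.banded b l)\<^sup>2) \<le> (\<Sum>l<n. (harmonic_seq l)\<^sup>2)"
      using b by (intro sum_mono power_mono D.banded_le D.banded_nonneg)
    also have "\<dots> \<le> 2" by (rule sum_harmonic_seq_sq)
    finally show "(\<Sum>l<n. (D.banded b l)\<^sup>2) \<le> 2" .
    have "(harm (2 * b))\<^sup>2 \<le> 25 * (harm 1)\<^sup>2 * sqrt (real (2 * b) / real 1)"
      using b by (intro harm_le_quarter_power) auto
    also have "\<dots> = 25 * sqrt (2 * real b)" by (simp add: harm_expand)
    also have "sqrt (2 * real b) \<le> 3 / 2 * real b"
    proof (rule real_le_lsqrt)
      have "2 * real b \<le> 9 / 4 * real b * real b" using b mult_mono[of 1 "real b" 1 "real b"] by simp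
      thus "2 * real b \<le> (3 / 2 * real b)\<^sup>2" by (simp add: power2_eq_square)
    qed auto
    finally have h: "(harm (2 * b))\<^sup>2 \<le> 75 / 2 * real b" by simp
    have "1 / 2 \<le> D.S (b - 1) * harm (2 * b)" using D_S_lower[of "b - 1"] b by simp
    hence "(1 / 2)\<^sup>2 \<le> (D.S (b - 1) * harm (2 * b))\<^sup>2" by (intro power_mono) auto
    also have "\<dots> \<le> (D.S (b - 1))\<^sup>2 * (75 / 2 * real b)"
      unfolding power_mult_distrib by (intro mult_left_mono h) auto
    also have "\<dots> \<le> (D.S (b - 1))\<^sup>2 * (75 / 2 * real (Suc b))"
      by (intro mult_left_mono) auto
    finally have "1 \<le> 150 * real (Suc b) * (D.S (b - 1))\<^sup>2" by (simp add: power2_eq_square algebra_simps)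
    thus "harmonic_seq b / (D.S (b - 1))\<^sup>2 \<le> 150"
      using D_S_pos[of "b - 1"] by (simp add: harmonic_seq_def field_simps)
  qed auto
  finally have s: "(sens d k b (toeplitz n (D.banded b)))\<^sup>2 \<le> 302 * real k" by simp
  have "(\<Sum>m<t. (D.S (min m (b - 1)))\<^sup>2) \<le> (\<Sum>m<t. (if m < b then (D.S m)\<^sup>2 else 0) + 1 / (harm b)\<^sup>2)"
  proof (rule sum_mono)
    fix m
    have "(D.S (b - 1))\<^sup>2 \<le> (1 / harm (Suc (b - 1)))\<^sup>2" by (intro power_mono D_S_upper D.S_nonneg)
    hence 1: "(D.S (b - 1))\<^sup>2 \<le> 1 / (harm b)\<^sup>2" using b by (simp add: power_divide)
    show "(D.S (min m (b - 1)))\<^sup>2 \<le> (if m < b then (D.S m)\<^sup>2 else 0) + 1 / (harm b)\<^sup>2"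
    proof (cases "m < b")
      case True
      hence "min m (b - 1) = m" by simp
      thus ?thesis using True by simp
    next
      case False
      hence "min m (b - 1) = b - 1" by simp
      thus ?thesis using False 1 by simp
    qed
  qed
  also have "\<dots> = (\<Sum>m<t. if m < b then (D.S m)\<^sup>2 else 0) + real t / (harm b)\<^sup>2"
    by (simp add: sum.distrib)
  also have "(\<Sum>m<t. if m < b then (D.S m)\<^sup>2 else 0) \<le> (\<Sum>m<b. (D.S m)\<^sup>2)"
  proof -
    have "(\<Sum>m<t. if m < b then (D.S m)\<^sup>2 else 0) = (\<Sum>m\<in>{..<t} \<inter> {m. m < b}. (D.S m)\<^sup>2)"
      by (simp add: sum.inter_restrict)
    also have "\<dots> \<le> (\<Sum>m<b. (D.S m)\<^sup>2)" by (intro sum_mono2) auto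
    finally show ?thesis .
  qed
  also have "(\<Sum>m<b. (D.S m)\<^sup>2) \<le> 50 * real b / (harm b)\<^sup>2" by (rule sum_D_S_sq[OF b(1)])
  also have "50 * real b / (harm b)\<^sup>2 + real t / (harm b)\<^sup>2 = (50 * real b + real t) / (harm b)\<^sup>2"
    by (simp add: add_divide_distrib)
  \<comment> \<open>The squared rate has a single power of ln (n / k), so (harm b)^2 is lowered to
    harm b, which dominates ln (b + 1); \<open>b\<close> in the numerator is traded for 2 n /
    k.\<close>
  also have "\<dots> \<le> (50 * (2 * (n / k)) + t) / ln (n / k)"
  proof (intro frac_le add_mono mult_left_mono)
    have "1 \<le> (harm b :: real)" using harm_mono[of 1 b, where 'a = real] b by (simp add: harm_expand)
    hence "(harm b :: real) * 1 \<le> (harm b)\<^sup>2" unfolding power2_eq_square by (intro mult_left_mono) auto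
    moreover have "ln (n / k) \<le> ln (real b + 1)"
    proof (rule ln_mono)
      show "real n / real k \<le> real b + 1" using kb(2) k1 b by (simp add: field_simps)
    qed (use nk in auto)
    ultimately show "ln (n / k) \<le> (harm b)\<^sup>2" using ln_le_harm[of b] by linarith
  qed (use kb(3) L in auto)
  also have "\<dots> \<le> 100 * ((t + n / k) / ln (n / k))"
    unfolding times_divide_eq_right using L by (intro divide_right_mono) auto
  finally have w: "(\<Sum>m<t. (D.S (min m (b - 1)))\<^sup>2) \<le> 100 * ((t + n / k) / ln (n / k))" by simp
  have "(sens d k b (toeplitz n (D.banded b)))\<^sup>2 * ((\<Sum>m<t. (D.S (min m (b - 1)))\<^sup>2) / (real t)\<^sup>2) \<le>
      (302 * real k) * (100 * ((t + n / k) / ln (n / k)) / (real t)\<^sup>2)"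
    by (intro mult_mono divide_right_mono s w) (auto intro!: divide_nonneg_nonneg sum_nonneg)
  also have "\<dots> = 30200 * (k / (t * ln (n / k)) * (1 + n / (real k * real t)))"
  proof -
    have "(t + n / k) / (real t)\<^sup>2 = (1 + n / (real k * real t)) / t"
      using t by (simp add: power2_eq_square add_divide_distrib)
    moreover have "(302 * real k) * (100 * ((t + n / k) / ln (n / k)) / (real t)\<^sup>2) =
        30200 * (k / ln (n / k) * ((t + n / k) / (real t)\<^sup>2))" by simp
    ultimately show ?thesis by simp
  qed
  also have "\<dots> \<le> 40000 * (k / (t * ln (n / k)) * (sqrt 1 + sqrt (n / (real k * real t)))\<^sup>2)"
    using L t by (intro mult_mono sum_squares_le_square_sum) auto
  also have "\<dots> = (200 * q)\<^sup>2"
    using L by (simp add: q_def power_mult_distrib power_divide)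
  finally show ?thesis .
qed

section \<open>The central binomial sequence\<close>

text \<open>The coefficients of (1 - X)^(-1/2), that is, the central binomial coefficients divided
  by 4^m.\<close>

definition binomial_seq :: "nat \<Rightarrow> real" where
  "binomial_seq m = \<bar>(-1/2 :: real) gchoose m\<bar>"

lemma binomial_seq_0: "binomial_seq 0 = 1"
  by (simp add: binomial_seq_def)

lemma binomial_seq_Suc: "binomial_seq (Suc m) = binomial_seq m * ((2 * real m + 1) / (2 * real m + 2))"
proof -
  have "real (Suc m) * ((-1/2 :: real) gchoose Suc m) = (-1/2 - real m) * ((-1/2) gchoose m)"
    using gbinomial_mult_1[of "-1/2 :: real" m] by (simp add: algebra_simps)
  hence "\<bar>real (Suc m) * ((-1/2 :: real) gchoose Suc m)\<bar> = \<bar>(-1/2 - real m) * ((-1/2) gchoose m)\<bar>" by simp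
  hence "real (Suc m) * binomial_seq (Suc m) = (1/2 + real m) * binomial_seq m"
    unfolding abs_mult binomial_seq_def by simp
  thus ?thesis by (simp add: field_simps)
qed

lemma binomial_seq_pos: "binomial_seq m > 0"
  by (induction m) (simp_all add: binomial_seq_0 binomial_seq_Suc)

text \<open>Log-convexity holds because the quotient (2 m + 1) / (2 m + 2) increases with m.\<close>

interpretation E: kaluza_seq binomial_seq
proof
  fix i m :: nat
  show "binomial_seq (Suc m) \<le> binomial_seq m"
    using binomial_seq_pos[of m] by (simp add: binomial_seq_Suc field_simps)
  assume im: "i \<le> m"
  have "(2 * real i + 1) / (2 * real i + 2) \<le> (2 * real m + 1) / (2 * real m + 2)"
    using im by (simp add: field_simps)
  hence "binomial_seq i * binomial_seq m * ((2 * real i + 1) / (2 * real i + 2)) \<le>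
      binomial_seq i * binomial_seq m * ((2 * real m + 1) / (2 * real m + 2))"
    by (intro mult_left_mono mult_nonneg_nonneg less_imp_le[OF binomial_seq_pos])
  thus "binomial_seq (Suc i) * binomial_seq m \<le> binomial_seq (Suc m) * binomial_seq i"
    by (simp add: binomial_seq_Suc mult_ac)
qed (simp_all add: binomial_seq_0 binomial_seq_pos)

lemma E1_sqrt_eq: "E1_sqrt n = toeplitz n binomial_seq"
  by (rule eq_matI) (auto simp: E1_sqrt_def binomial_seq_def)

text \<open>Carries \<open>E1_sqrt_square\<close> over to series: coefficient \<open>m\<close> is
  the lower left entry of the matrix of size \<open>Suc m\<close>.\<close>

lemma binomial_seq_square: "Abs_fps binomial_seq * Abs_fps binomial_seq = Abs_fps (\<lambda>_. 1)"
proof (rule fps_ext)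
  fix m
  have "toeplitz (Suc m) (fps_nth (Abs_fps binomial_seq * Abs_fps binomial_seq)) $$ (m, 0) = E1 (Suc m) $$ (m, 0)"
    using E1_sqrt_square[of "Suc m"] toeplitz_mult[of "Suc m" "Abs_fps binomial_seq" "Abs_fps binomial_seq"]
    by (simp add: E1_sqrt_eq Abs_fps_inverse)
  thus "fps_nth (Abs_fps binomial_seq * Abs_fps binomial_seq) m = fps_nth (Abs_fps (\<lambda>_. 1)) m"
    by (simp add: E1_def)
qed

text \<open>If f^2 = 1 / (1 - X), then the partial sums of 1 / f have the series f. Formally, both
  series multiplied by f give 1 / (1 - X), and f cancels.\<close>

lemma E_S: "E.S m = binomial_seq m"
proof -
  have "Abs_fps E.S * Abs_fps binomial_seq = Abs_fps (\<lambda>_. 1)"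
    by (rule fps_ext) (simp add: fps_mult_nth_atMost E.S_conv)
  also have "\<dots> = Abs_fps binomial_seq * Abs_fps binomial_seq" by (simp add: binomial_seq_square)
  finally have "(Abs_fps E.S - Abs_fps binomial_seq) * Abs_fps binomial_seq = 0" by (simp add: algebra_simps)
  moreover have "fps_nth (Abs_fps binomial_seq) 0 \<noteq> 0" by (simp add: binomial_seq_0)
  hence "Abs_fps binomial_seq \<noteq> 0" by (metis fps_zero_nth)
  ultimately have "Abs_fps E.S = Abs_fps binomial_seq" by simp
  hence "fps_nth (Abs_fps E.S) m = fps_nth (Abs_fps binomial_seq) m" by simp
  thus ?thesis by simp
qed

text \<open>Wallis-type bounds, here and for the lower estimate: equality at m = 0, and in either
  induction step the two polynomials compared differ by exactly 1.\<close>

lemma binomial_seq_sq_upper: "(binomial_seq m)\<^sup>2 \<le> 1 / (2 * real m + 1)"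
proof (induction m)
  case (Suc m)
  have "(2 * real m + 1) * (2 * real m + 3) \<le> (2 * real m + 2)\<^sup>2"
    by (simp add: power2_eq_square algebra_simps)
  hence "1 / (2 * real m + 1) * ((2 * real m + 1) / (2 * real m + 2))\<^sup>2 \<le> 1 / (2 * real m + 3)"
    by (simp add: power_divide power2_eq_square[of "2 * real m + 1"] divide_simps)
  moreover have "(binomial_seq (Suc m))\<^sup>2 \<le> 1 / (2 * real m + 1) * ((2 * real m + 1) / (2 * real m + 2))\<^sup>2"
    unfolding binomial_seq_Suc power_mult_distrib by (intro mult_right_mono Suc.IH) simp
  ultimately have "(binomial_seq (Suc m))\<^sup>2 \<le> 1 / (2 * real m + 3)" by (rule order.trans[rotated])
  thus ?case by (simp add: add_ac)
qed (simp add: binomial_seq_0)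

lemma binomial_seq_sq_lower: "1 / (4 * real m + 1) \<le> (binomial_seq m)\<^sup>2"
proof (induction m)
  case (Suc m)
  have "(4 * real m + 1) * (2 * real m + 2)\<^sup>2 \<le> (2 * real m + 1)\<^sup>2 * (4 * real m + 5)"
    by (simp add: power2_eq_square algebra_simps)
  hence "1 / (4 * real m + 5) \<le> 1 / (4 * real m + 1) * ((2 * real m + 1) / (2 * real m + 2))\<^sup>2"
    by (simp add: power_divide divide_simps)
  also have "\<dots> \<le> (binomial_seq (Suc m))\<^sup>2"
    unfolding binomial_seq_Suc power_mult_distrib by (intro mult_right_mono Suc.IH) simp
  finally show ?case by (simp add: add_ac)
qed (simp add: binomial_seq_0)

lemma binomial_seq_sq_le: "(binomial_seq m)\<^sup>2 \<le> 1 / real (Suc m)"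
  by (rule order.trans[OF binomial_seq_sq_upper]) (intro frac_le, auto)

lemma sum_binomial_seq_sq: "(\<Sum>l<n. (binomial_seq l)\<^sup>2) \<le> harm n"
  unfolding sum_inverse_Suc_eq_harm[symmetric] by (intro sum_mono binomial_seq_sq_le)

lemma binomial_seq_le: "binomial_seq m \<le> 1 / sqrt (real (Suc m))"
  using real_sqrt_le_mono[OF binomial_seq_sq_le[of m]] binomial_seq_pos[of m]
  by (simp add: real_sqrt_divide)

lemma binomial_seq_correlation_le:
  assumes "1 \<le> m"
  shows "(\<Sum>l<n. binomial_seq l * binomial_seq (l + m)) \<le> 2 * sqrt (real n / real m)"
proof -
  have "binomial_seq l * binomial_seq (l + m) \<le> 1 / sqrt (real (Suc l)) * (1 / sqrt (real m))" for l
  proof (intro mult_mono binomial_seq_le)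
    have "binomial_seq (l + m) \<le> 1 / sqrt (real (Suc (l + m)))" by (rule binomial_seq_le)
    also have "\<dots> \<le> 1 / sqrt (real m)" using assms by (intro divide_left_mono) auto
    finally show "binomial_seq (l + m) \<le> 1 / sqrt (real m)" .
  qed (auto intro: less_imp_le binomial_seq_pos)
  hence "(\<Sum>l<n. binomial_seq l * binomial_seq (l + m)) \<le> (\<Sum>l<n. 1 / sqrt (real (Suc l)) * (1 / sqrt (real m)))"
    by (intro sum_mono)
  also have "\<dots> = (\<Sum>l<n. 1 / sqrt (real (Suc l))) * (1 / sqrt (real m))" by (simp only: sum_distrib_right)
  also have "\<dots> \<le> (2 * sqrt (real n)) * (1 / sqrt (real m))" by (intro mult_right_mono sum_inverse_sqrt_le) auto
  finally show ?thesis by (simp add: real_sqrt_divide)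
qed

text \<open>A lag of at least s b has correlation at most 2 sqrt (k / s), and these bounds sum to
  order k: this is the summand \<open>k\<close> of the rate, while the diagonal gives sqrt (k ln
  n).\<close>

lemma sens_E1_sqrt_le:
  assumes b: "1 \<le> b" "b \<le> n" and k: "k = max_part n b" and n: "2 \<le> n"
  shows "(sens d k b (toeplitz n binomial_seq))\<^sup>2 \<le> 8 * (sqrt (k * ln n) + k)\<^sup>2"
proof -
  note kb = max_part_bounds[OF b k]
  have k1: "1 \<le> k" by (rule kb)
  define g where "g s = 2 * sqrt (real k / real s)" for s
  have "(sens d k b (toeplitz n binomial_seq))\<^sup>2 \<le>
      real k * ((\<Sum>l<n. (binomial_seq l)\<^sup>2) + 2 * (\<Sum>s\<in>{1..<k}. g s))"
  proof (rule sens_toeplitz_le[OF less_imp_le[OF E.a_pos] b(1) k])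
    fix m s :: nat assume s: "1 \<le> s" "s * b \<le> m"
    have "1 * 1 \<le> s * b" using s b by (intro mult_le_mono)
    hence m: "1 \<le> m" using s by linarith
    have "real (s * b) \<le> real m" using s by (simp only: of_nat_le_iff)
    hence "real n / real m \<le> real n / (real s * real b)"
      using s b m by (intro divide_left_mono) auto
    also have "\<dots> = (real n / real b) / real s" by simp
    also have "\<dots> \<le> real k / real s" by (intro divide_right_mono kb) auto
    finally have "real n / real m \<le> real k / real s" .
    hence "2 * sqrt (real n / real m) \<le> g s" unfolding g_def by simp
    with binomial_seq_correlation_le[OF m, of n] show "(\<Sum>l<n. binomial_seq l * binomial_seq (l + m)) \<le> g s"
      by linarith
  qed (simp add: g_def)
  also have "\<dots> \<le> real k * (3 * ln n + 2 * (4 * real k))"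
  proof (intro mult_left_mono add_mono)
    show "(\<Sum>l<n. (binomial_seq l)\<^sup>2) \<le> 3 * ln n"
      using sum_binomial_seq_sq[of n] harm_le_3_ln[OF n] by linarith
    have "(\<Sum>s\<in>{1..<k}. g s) = (\<Sum>i<k - 1. 2 * sqrt k * (1 / sqrt (real (Suc i))))"
      by (rule sum.reindex_bij_witness[of _ Suc "\<lambda>s. s - 1"]) (auto simp: g_def real_sqrt_divide)
    also have "\<dots> \<le> (\<Sum>i<k. 2 * sqrt k * (1 / sqrt (real (Suc i))))" by (intro sum_mono2) auto
    also have "\<dots> = 2 * sqrt k * (\<Sum>i<k. 1 / sqrt (real (Suc i)))" by (simp only: sum_distrib_left)
    also have "\<dots> \<le> 2 * sqrt k * (2 * sqrt k)" by (intro mult_left_mono sum_inverse_sqrt_le) auto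
    finally show "(\<Sum>s\<in>{1..<k}. g s) \<le> 4 * real k" by simp
  qed auto
  also have "\<dots> \<le> 8 * (k * ln n + (real k)\<^sup>2)" using n by (simp add: power2_eq_square algebra_simps)
  also have "\<dots> \<le> 8 * (sqrt (k * ln n) + sqrt ((real k)\<^sup>2))\<^sup>2"
    using n by (intro mult_left_mono sum_squares_le_square_sum) auto
  finally show ?thesis by simp
qed

lemma error_E1_sqrt:
  assumes b: "1 \<le> b" "b \<le> n" and k: "k = max_part n b" and t: "2 \<le> t" "t \<le> n"
  defines "q \<equiv> sqrt (ln t) * (sqrt (k * ln n) + k) / t"
  shows "(sens d k b (toeplitz n binomial_seq))\<^sup>2 * ((\<Sum>m<t. (E.S m)\<^sup>2) / (real t)\<^sup>2) \<le> (5 * q)\<^sup>2"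
proof -
  let ?x = "sqrt (k * ln n) + k"
  have lt: "ln t > 0" using t by simp
  have "(\<Sum>m<t. (E.S m)\<^sup>2) \<le> 3 * ln t"
    unfolding E_S using sum_binomial_seq_sq[of t] harm_le_3_ln[OF t(1)] by linarith
  hence "(sens d k b (toeplitz n binomial_seq))\<^sup>2 * ((\<Sum>m<t. (E.S m)\<^sup>2) / (real t)\<^sup>2) \<le>
      (8 * ?x\<^sup>2) * ((3 * ln t) / (real t)\<^sup>2)"
    using t by (intro mult_mono divide_right_mono sens_E1_sqrt_le b k) (auto intro!: divide_nonneg_nonneg sum_nonneg)
  also have "\<dots> = 24 * (?x\<^sup>2 * ln t / (real t)\<^sup>2)" by simp
  \<comment> \<open>Rounds 8 * 3 = 24 up to a square.\<close>
  also have "\<dots> \<le> 25 * (?x\<^sup>2 * ln t / (real t)\<^sup>2)" using lt by (intro mult_right_mono) auto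
  also have "\<dots> = (5 * q)\<^sup>2"
    using lt by (simp add: q_def power_mult_distrib power_divide)
  finally show ?thesis .
qed

text \<open>Only the first \<open>p\<close> squares cost \<open>harm p\<close>; the tail and the
  correlations are bounded by constants. The latter needs p = O(sqrt b), which the logarithmic
  bandwidth provides. Finally harm p + 17 \<le> 18 harm p.\<close>

lemma sens_E1_sqrt_banded_le:
  assumes b: "1 \<le> b" and k: "k = max_part n b" and p: "1 \<le> p" "p \<le> b" "real p \<le> ln b + 1"
  shows "(sens d k b (toeplitz n (E.banded p)))\<^sup>2 \<le> 18 * (k * harm p)"
proof -
  let ?r = binomial_seq
  have r: "?r m > 0" for m by (rule binomial_seq_pos)
  have hp: "1 \<le> (harm p :: real)" using harm_mono[of 1 p, where 'a = real] p by (simp add: harm_expand)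
  have "(sens d k b (toeplitz n (E.banded p)))\<^sup>2 \<le>
      real k * ((\<Sum>l<n. (E.banded p l)\<^sup>2) + 2 * (?r b / (E.S (p - 1))\<^sup>2))"
    using p by (intro E.sens_banded_le k) (auto simp: E_S r)
  also have "\<dots> \<le> real k * ((harm p + 1) + 2 * 8)"
  proof (intro mult_left_mono add_mono)
    \<comment> \<open>Past the bandwidth one factor is at most r_p and the other is summed: the
      total mass is at most 1 / r_(p-1), so the tail contributes at most 1.\<close>
    have "(E.banded p l)\<^sup>2 \<le> (if l < p then (?r l)\<^sup>2 else 0) + ?r p * E.banded p l" for l
    proof (cases "l < p")
      case True
      have "(E.banded p l)\<^sup>2 \<le> (?r l)\<^sup>2" by (intro power_mono E.banded_le E.banded_nonneg p)
      moreover have "0 \<le> ?r p * E.banded p l"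
        using less_imp_le[OF r] E.banded_nonneg[OF p(1)] by (intro mult_nonneg_nonneg)
      ultimately show ?thesis using True by simp
    next
      case False
      have "E.banded p l \<le> ?r p" using E.banded_le[OF p(1), of l] E.a_antimono[of p l] False by simp
      hence "E.banded p l * E.banded p l \<le> ?r p * E.banded p l"
        by (intro mult_right_mono E.banded_nonneg p)
      thus ?thesis using False by (simp add: power2_eq_square)
    qed
    hence "(\<Sum>l<n. (E.banded p l)\<^sup>2) \<le> (\<Sum>l<n. (if l < p then (?r l)\<^sup>2 else 0) + ?r p * E.banded p l)"
      by (intro sum_mono)
    also have "\<dots> = (\<Sum>l<n. if l < p then (?r l)\<^sup>2 else 0) + ?r p * (\<Sum>l<n. E.banded p l)"
      by (simp add: sum.distrib sum_distrib_left)
    also have "\<dots> \<le> harm p + 1"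
    proof (rule add_mono)
      have "(\<Sum>l<n. if l < p then (?r l)\<^sup>2 else 0) = (\<Sum>l\<in>{..<n} \<inter> {l. l < p}. (?r l)\<^sup>2)"
        by (simp add: sum.inter_restrict)
      also have "\<dots> \<le> (\<Sum>l<p. (?r l)\<^sup>2)" by (intro sum_mono2) auto
      also have "\<dots> \<le> harm p" by (rule sum_binomial_seq_sq)
      finally show "(\<Sum>l<n. if l < p then (?r l)\<^sup>2 else 0) \<le> harm p" .
      have "?r p * (\<Sum>l<n. E.banded p l) \<le> ?r (p - 1) * (\<Sum>l\<le>n. E.banded p l)"
        by (intro mult_mono E.a_antimono sum_mono2 sum_nonneg less_imp_le[OF r])
          (auto intro: E.banded_nonneg[OF p(1)])
      also have "\<dots> \<le> 1" using E.banded_sum[OF p(1), of n] by (simp add: E_S)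
      finally show "?r p * (\<Sum>l<n. E.banded p l) \<le> 1" .
    qed
    finally show "(\<Sum>l<n. (E.banded p l)\<^sup>2) \<le> harm p + 1" .
    have sb: "sqrt b \<ge> 1" using b by simp
    \<comment> \<open>Applying ln x \<le> x - 1 at the root gives ln b \<le> 2 (sqrt b - 1), hence p
      \<le> 2 sqrt b.\<close>
    have "ln (sqrt b) \<le> sqrt b - 1" using b by (intro ln_le_minus_one) simp
    hence "ln (real b) \<le> 2 * (sqrt b - 1)" using b by (simp add: ln_sqrt)
    hence pb: "real p \<le> 2 * sqrt b" using p(3) by simp
    have "1 / (4 * real p) \<le> 1 / (4 * real (p - 1) + 1)" using p by (intro divide_left_mono) auto
    also have "\<dots> \<le> (?r (p - 1))\<^sup>2" by (rule binomial_seq_sq_lower)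
    finally have lower: "1 / (4 * real p) \<le> (?r (p - 1))\<^sup>2" .
    have "?r b \<le> 1 / sqrt (real (Suc b))" by (rule binomial_seq_le)
    also have "\<dots> \<le> 1 / sqrt b" using b by (intro divide_left_mono) auto
    finally have "?r b / (?r (p - 1))\<^sup>2 \<le> (1 / sqrt b) / (1 / (4 * real p))"
      using lower p by (intro frac_le) auto
    also have "\<dots> = 4 * real p / sqrt b" by simp
    also have "\<dots> \<le> 4 * (2 * sqrt b) / sqrt b" using pb by (intro divide_right_mono) auto
    also have "\<dots> = 8" using sb by simp
    finally show "?r b / (E.S (p - 1))\<^sup>2 \<le> 8" by (simp add: E_S)
  qed auto
  also have "\<dots> \<le> real k * (18 * harm p)" using hp by (intro mult_left_mono) auto
  finally show ?thesis by simp
qed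

lemma sum_E_S_cutoff_sq:
  assumes p: "1 \<le> p"
  shows "(\<Sum>m<t. (E.S (min m (p - 1)))\<^sup>2) \<le> harm p + t / p"
proof -
  have "(\<Sum>m<t. (E.S (min m (p - 1)))\<^sup>2) \<le> (\<Sum>m<t. (if m < p then (binomial_seq m)\<^sup>2 else 0) + 1 / p)"
  proof (rule sum_mono)
    fix m
    show "(E.S (min m (p - 1)))\<^sup>2 \<le> (if m < p then (binomial_seq m)\<^sup>2 else 0) + 1 / p"
    proof (cases "m < p")
      case True
      hence "min m (p - 1) = m" by simp
      thus ?thesis using True by (simp add: E_S)
    next
      case False
      hence "min m (p - 1) = p - 1" by simp
      thus ?thesis using False binomial_seq_sq_le[of "p - 1"] p by (simp add: E_S)
    qed
  qed
  also have "\<dots> = (\<Sum>m<t. if m < p then (binomial_seq m)\<^sup>2 else 0) + t / p"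
    by (simp add: sum.distrib)
  also have "(\<Sum>m<t. if m < p then (binomial_seq m)\<^sup>2 else 0) = (\<Sum>m\<in>{..<t} \<inter> {m. m < p}. (binomial_seq m)\<^sup>2)"
    by (simp add: sum.inter_restrict)
  also have "\<dots> \<le> (\<Sum>m<p. (binomial_seq m)\<^sup>2)" by (intro sum_mono2) auto
  also have "\<dots> \<le> harm p" by (rule sum_binomial_seq_sq)
  finally show ?thesis by simp
qed

text \<open>From n / k \<le> b \<le> 2 n / k, ln b lies between L = ln (n / k) and L + ln 2. The
  additive ln 2 + 1 from rounding is below 2 \<le> 2 L, hence the 3; and ln b \<le> b - 1 gives p
  \<le> b.\<close>

lemma bandwidth_ln_bounds:
  assumes b: "1 \<le> b" "b \<le> n" and k: "k = max_part n b" and L: "1 \<le> ln (real n / real k)"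
    and p: "p = nat \<lceil>ln (real b)\<rceil>"
  shows "ln (real n / real k) \<le> real p" and "real p \<le> 3 * ln (real n / real k)"
    and "1 \<le> p" and "p \<le> b" and "real p \<le> ln b + 1"
proof -
  note kb = max_part_bounds[OF b k]
  let ?L = "ln (real n / real k)"
  have x: "real n / real k > 0" using b kb(1) by simp
  have "real n / real k \<le> real b" using kb(1,2) b by (simp add: field_simps)
  hence Lb: "?L \<le> ln b" using x b by (subst ln_le_cancel_iff) auto
  have pr: "real p = real_of_int \<lceil>ln (real b)\<rceil>" using Lb L unfolding p by (simp add: of_nat_nat)
  show "?L \<le> real p" using Lb unfolding pr by linarith
  with L show "1 \<le> p" by linarith
  show pl: "real p \<le> ln b + 1" unfolding pr by linarith
  have "ln (real b) \<le> ln (2 * (real n / real k))" using kb(3) x b by (subst ln_le_cancel_iff) auto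
  also have "\<dots> = ln 2 + ?L" using x by (intro ln_mult_pos) auto
  finally show "real p \<le> 3 * ?L" using pl L ln_2_less_1 by linarith
  have "ln (real b) \<le> real b - 1" using b by (intro ln_le_minus_one) simp
  hence "real p \<le> real b" using pl by linarith
  thus "p \<le> b" by simp
qed

text \<open>
  For \<open>ln (n / k) < 2\<close> the iterated logarithms may vanish; the terms
  \<open>k ln (n / k) / n\<close> and \<open>k / ln (n / k)\<close> then are bounded below by constants.
\<close>

lemma loglog_rate_bounds:
  assumes b: "1 \<le> b" "b \<le> n" and k: "k = max_part n b" and L: "1 \<le> ln (real n / real k)"
    and p: "p = nat \<lceil>ln (real b)\<rceil>" and t: "1 \<le> t"
  defines "L \<equiv> ln (real n / real k)"
  shows "harm p \<le> 24 * (ln L + real k * L / real n)"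
    and "harm p / real t + 1 / real p \<le> 8 * (real k / L + ln L / real t)"
proof -
  note kb = max_part_bounds[OF b k]
  note pb = bandwidth_ln_bounds[OF b k L p, folded L_def]
  have L1: "1 \<le> L" using L by (simp add: L_def)
  have k1: "1 \<le> real k" using kb(1) by simp
  have lL: "0 \<le> ln L" using L1 by simp
  have kLn: "0 \<le> real k * L / real n" using L1 by simp
  have kL: "1 / L \<le> real k / L" using k1 L1 by (intro divide_right_mono) auto
  have ip: "1 / real p \<le> 1 / L" using pb(1) L1 by (intro divide_left_mono) auto
  have ln2: "2 / 3 \<le> ln (2 :: real)" by (rule ln2_ge_two_thirds)
  have ln3: "ln (3 :: real) \<le> 6 / 5"
  proof -
    have "ln (3 :: real) = ln 2 + ln (3 / 2)" by (subst ln_mult_pos[symmetric]) auto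
    also have "ln (3 / 2 :: real) \<le> 3 / 2 - 1" by (intro ln_le_minus_one) simp
    finally show ?thesis using ln2_le_25_over_36 by linarith
  qed
  have "harm p \<le> 1 + ln (real p)" by (rule harm_le_ln[OF pb(3)])
  also have "ln (real p) \<le> ln (3 * L)" using pb(2,3) L1 by (subst ln_le_cancel_iff) auto
  also have "\<dots> = ln 3 + ln L" using L1 by (intro ln_mult_pos) auto
  finally have hp: "harm p \<le> 11 / 5 + ln L" using ln3 by linarith
  have "harm p \<le> 24 * (ln L + real k * L / real n) \<and> harm p / real t + 1 / real p \<le> 8 * (real k / L + ln L / real t)"
  proof (cases "L < 2")
    case False
    \<comment> \<open>For L \<ge> 2, ln L \<ge> 2 / 3 absorbs the additive 11 / 5.\<close>
    have "ln 2 \<le> ln L" using False by (subst ln_le_cancel_iff) auto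
    hence h: "harm p \<le> 8 * ln L" using hp ln2 by linarith
    have "harm p / real t \<le> 8 * ln L / real t" by (intro divide_right_mono h) auto
    also have "8 * ln L / real t = 8 * (ln L / real t)" by simp
    finally have ht: "harm p / real t \<le> 8 * (ln L / real t)" .
    have add: "x + y \<le> 8 * (v + w)" if "x \<le> 8 * w" "y \<le> v" "0 \<le> v" for x y v w :: real
      using that by simp
    have "0 \<le> real k / L" using k1 L1 by simp
    hence "harm p / real t + 1 / real p \<le> 8 * (real k / L + ln L / real t)"
      by (rule add[OF ht order.trans[OF ip kL]])
    thus ?thesis using h lL kLn by auto
  next
    case True
    have "ln L \<le> ln 2" using True L1 by (subst ln_le_cancel_iff) auto
    hence h: "harm p \<le> (29 / 10 :: real)" using hp ln2_le_25_over_36 by linarith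
    \<comment> \<open>For L < 2, n / k is below e^2 \<le> 7.6, so k L / n is at least 1 / 7.6; the
      constant 24 exceeds 2.9 * 7.6.\<close>
    have "real n / real k = exp L" unfolding L_def using kb(1) b by simp
    also have "\<dots> \<le> exp 2" using True by simp
    also have "exp (2 :: real) = exp 1 * exp 1" by (simp add: exp_add[symmetric])
    also have "\<dots> \<le> (11 / 4) * (11 / 4)" using e_less_272 by (intro mult_mono) auto
    also have "\<dots> \<le> 7.6" by simp
    finally have "1 \<le> 7.6 * (real k / real n)" using kb(1) b by (simp add: field_simps)
    also have "\<dots> \<le> 7.6 * (real k / real n * L)"
      by (rule mult_left_mono) (use mult_left_mono[OF L1, of "real k / real n"] in simp_all)
    finally have 1: "1 \<le> 7.6 * (real k * L / real n)" by simp
    \<comment> \<open>The left side is at most 2.9 + 1, while k / L \<ge> 1 / 2 makes the right side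
      at least 4; this fixes the 8.\<close>
    have "harm p / real t \<le> 29 / 10 / 1" using t by (intro frac_le h) (auto simp: harm_nonneg)
    moreover have "1 / real p \<le> 1 / 1" using pb(3) by (intro divide_left_mono) auto
    moreover have "1 / 2 \<le> 1 / L" using True L1 by (intro divide_left_mono) auto
    moreover have "0 \<le> ln L / real t" using lL by simp
    ultimately have "harm p / real t + 1 / real p \<le> 8 * (real k / L + ln L / real t)"
      unfolding distrib_left using kL by linarith
    moreover have "x \<le> 24 * (y + z)" if "x \<le> 29 / 10" "1 \<le> 7.6 * z" "0 \<le> y" for x y z :: real
      using that by simp
    from this[OF h 1 lL] have "harm p \<le> 24 * (ln L + real k * L / real n)" .
    ultimately show ?thesis by blast
  qed
  thus "harm p \<le> 24 * (ln L + real k * L / real n)"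
    and "harm p / real t + 1 / real p \<le> 8 * (real k / L + ln L / real t)" by auto
qed

text \<open>\<open>X\<close> and \<open>Y\<close> are the two bracketed factors of the rate:
  \<open>X\<close> comes from the sensitivity, \<open>Y\<close> from the row norm of
  \<open>B\<close>. The constant is 18 * 24 * 8 = 3456 \<le> 60^2.\<close>

lemma error_E1_sqrt_banded:
  assumes b: "1 \<le> b" "b \<le> n" and k: "k = max_part n b" and t: "1 \<le> t"
    and L: "1 \<le> ln (real n / real k)" and p: "p = nat \<lceil>ln (real b)\<rceil>"
  defines "q \<equiv> sqrt k / sqrt t *
    (sqrt (ln (ln (real n / real k))) + sqrt (real k * ln (real n / real k) / real n)) *
    (sqrt k / sqrt (ln (real n / real k)) + sqrt (ln (ln (real n / real k))) / sqrt t)"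
  shows "(sens d k b (toeplitz n (E.banded p)))\<^sup>2 *
    ((\<Sum>m<t. (E.S (min m (p - 1)))\<^sup>2) / (real t)\<^sup>2) \<le> (60 * q)\<^sup>2"
proof -
  define L where "L = ln (real n / real k)"
  have L1: "1 \<le> L" using L by (simp add: L_def)
  have lL: "0 \<le> ln L" using L1 by simp
  note pb = bandwidth_ln_bounds[OF b k L p]
  note rb = loglog_rate_bounds[OF b k L p t, folded L_def]
  define X where "X = sqrt (ln L) + sqrt (real k * L / real n)"
  define Y where "Y = sqrt k / sqrt L + sqrt (ln L) / sqrt t"
  have "harm p \<le> 24 * (ln L + real k * L / real n)" by (rule rb)
  also have "\<dots> \<le> 24 * X\<^sup>2"
    unfolding X_def using lL L1 by (intro mult_left_mono sum_squares_le_square_sum) auto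
  finally have hX: "harm p \<le> 24 * X\<^sup>2" .
  have "harm p / real t + 1 / real p \<le> 8 * (real k / L + ln L / real t)" by (rule rb)
  also have "\<dots> \<le> 8 * (sqrt (real k / L) + sqrt (ln L / real t))\<^sup>2"
    using lL L1 by (intro mult_left_mono sum_squares_le_square_sum) auto
  also have "sqrt (real k / L) + sqrt (ln L / real t) = Y" by (simp add: Y_def real_sqrt_divide)
  finally have hY: "harm p / real t + 1 / real p \<le> 8 * Y\<^sup>2" .
  have "(\<Sum>m<t. (E.S (min m (p - 1)))\<^sup>2) / (real t)\<^sup>2 \<le> (harm p + real t / real p) / (real t)\<^sup>2"
    by (intro divide_right_mono sum_E_S_cutoff_sq pb) auto
  also have "\<dots> = 1 / t * (harm p / real t + 1 / real p)"
    using t by (simp add: power2_eq_square add_divide_distrib distrib_left)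
  also have "\<dots> \<le> 1 / t * (8 * Y\<^sup>2)" by (intro mult_left_mono hY) auto
  finally have w: "(\<Sum>m<t. (E.S (min m (p - 1)))\<^sup>2) / (real t)\<^sup>2 \<le> 1 / t * (8 * Y\<^sup>2)" .
  have "(sens d k b (toeplitz n (E.banded p)))\<^sup>2 \<le> 18 * (k * harm p)"
    by (rule sens_E1_sqrt_banded_le[OF b(1) k pb(3,4,5)])
  also have "\<dots> \<le> 18 * (k * (24 * X\<^sup>2))" by (intro mult_left_mono hX) auto
  finally have "(sens d k b (toeplitz n (E.banded p)))\<^sup>2 *
    ((\<Sum>m<t. (E.S (min m (p - 1)))\<^sup>2) / (real t)\<^sup>2) \<le> (18 * (k * (24 * X\<^sup>2))) * (1 / t * (8 * Y\<^sup>2))"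
    using w by (intro mult_mono) (auto intro!: divide_nonneg_nonneg sum_nonneg)
  also have "\<dots> = 3456 * (k / t * X\<^sup>2 * Y\<^sup>2)" by simp
  also have "\<dots> \<le> 3600 * (k / t * X\<^sup>2 * Y\<^sup>2)" by (intro mult_right_mono) auto
  also have "k / t * X\<^sup>2 * Y\<^sup>2 = q\<^sup>2"
    unfolding q_def L_def[symmetric] X_def[symmetric] Y_def[symmetric] power_mult_distrib power_divide by simp
  also have "3600 * q\<^sup>2 = (60 * q)\<^sup>2" by simp
  finally show ?thesis .
qed

section \<open>Assembling the four bounds\<close>

lemma (in kaluza_seq) toeplitz_error_rate:
  assumes M: "prob_space M" and X: "bernoulli_rows M n d \<mu> X"
    and Z: "gaussian_entries M n d (noise_variance d k b 1 \<epsilon> \<delta> (toeplitz n a)) Z"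
    and S_pos: "\<And>m. S m > 0"
    and q: "(sens d k b (toeplitz n a))\<^sup>2 * ((\<Sum>m<t. (S m)\<^sup>2) / (real t)\<^sup>2) \<le> (K * q)\<^sup>2" "0 \<le> q" "0 \<le> K"
    and t: "1 \<le> t" "t \<le> n" and rest: "1 \<le> d" "0 < \<beta>" "\<beta> < 1" "0 < \<epsilon>" "0 < \<delta>" "\<delta> < 1"
      "noise_sigma \<epsilon> \<delta> \<le> \<kappa> * (sqrt (ln (1 / \<delta>)) / \<epsilon>)" "1 \<le> c'" "2 * \<kappa> * K \<le> c'"
      "r = sampling_rate d 1 \<beta> t + q * sqrt d * (sqrt (ln (1 / \<delta>)) / \<epsilon>) * (sqrt d + sqrt (ln (1 / \<beta>)))"
  shows "1 - 2 * \<beta> \<le>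
    measure M {\<omega> \<in> space M. vec_l2 (private_mean n (toeplitz n a) (X \<omega>) (Z \<omega>) t - \<mu>) \<le> c' * r}"
  by (rule prob_space.mechanism_error_rate[OF M X Z toeplitz_carrier toeplitz_carrier mat_inv_toeplitz_a
        toeplitz_c_mult_a running_mean_mult_toeplitz_c[OF t] S_pos q t rest])

lemma (in kaluza_seq) banded_error_rate:
  assumes M: "prob_space M" and X: "bernoulli_rows M n d \<mu> X"
    and Z: "gaussian_entries M n d (noise_variance d k b 1 \<epsilon> \<delta> (toeplitz n (banded p))) Z"
    and S_pos: "\<And>m. S m > 0" and p: "1 \<le> p"
    and q: "(sens d k b (toeplitz n (banded p)))\<^sup>2 * ((\<Sum>m<t. (S (min m (p - 1)))\<^sup>2) / (real t)\<^sup>2) \<le> (K * q)\<^sup>2"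
      "0 \<le> q" "0 \<le> K"
    and t: "1 \<le> t" "t \<le> n" and rest: "1 \<le> d" "0 < \<beta>" "\<beta> < 1" "0 < \<epsilon>" "0 < \<delta>" "\<delta> < 1"
      "noise_sigma \<epsilon> \<delta> \<le> \<kappa> * (sqrt (ln (1 / \<delta>)) / \<epsilon>)" "1 \<le> c'" "2 * \<kappa> * K \<le> c'"
      "r = sampling_rate d 1 \<beta> t + q * sqrt d * (sqrt (ln (1 / \<delta>)) / \<epsilon>) * (sqrt d + sqrt (ln (1 / \<beta>)))"
  shows "1 - 2 * \<beta> \<le>
    measure M {\<omega> \<in> space M. vec_l2 (private_mean n (toeplitz n (banded p)) (X \<omega>) (Z \<omega>) t - \<mu>) \<le> c' * r}"
  by (rule prob_space.mechanism_error_rate[OF M X Z toeplitz_carrier toeplitz_carrier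
        mat_inv_toeplitz_banded(1)[OF p] mat_inv_toeplitz_banded(2)[OF p]
        running_mean_mult_toeplitz_cutoff[OF p t] S_pos q t rest])

text \<open>The additive ln 1.25 is turned into a multiple of ln (1 / \<delta>), which is possible
  because \<delta> \<le> \<open>\<delta>\<^sub>0\<close> keeps that logarithm at least ln (1 /
  \<open>\<delta>\<^sub>0\<close>) > 0.\<close>

lemma noise_sigma_le:
  assumes "0 < \<delta>" "\<delta> \<le> \<delta>\<^sub>0" "\<delta>\<^sub>0 < 1" "0 < \<epsilon>"
  shows "noise_sigma \<epsilon> \<delta> \<le> sqrt (2 * (1 + ln 1.25 / ln (1 / \<delta>\<^sub>0))) * (sqrt (ln (1 / \<delta>)) / \<epsilon>)"
proof -
  have l0: "0 < ln (1 / \<delta>\<^sub>0)" using assms by simp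
  have "1 / \<delta>\<^sub>0 \<le> 1 / \<delta>" using assms by (intro divide_left_mono) auto
  hence le: "ln (1 / \<delta>\<^sub>0) \<le> ln (1 / \<delta>)" using assms by (subst ln_le_cancel_iff) auto
  have "ln (1.25 / \<delta>) = ln 1.25 + ln (1 / \<delta>)"
    using ln_mult_pos[of "1.25" "1 / \<delta>"] assms by simp
  also have "ln 1.25 \<le> ln 1.25 / ln (1 / \<delta>\<^sub>0) * ln (1 / \<delta>)"
    using mult_left_mono[OF le, of "ln 1.25 / ln (1 / \<delta>\<^sub>0)"] l0 by simp
  finally have "2 * ln (1.25 / \<delta>) \<le> 2 * (1 + ln 1.25 / ln (1 / \<delta>\<^sub>0)) * ln (1 / \<delta>)" by (simp add: algebra_simps)
  hence "sqrt (2 * ln (1.25 / \<delta>)) \<le> sqrt (2 * (1 + ln 1.25 / ln (1 / \<delta>\<^sub>0))) * sqrt (ln (1 / \<delta>))"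
    unfolding real_sqrt_mult[symmetric] by (rule real_sqrt_le_mono)
  hence "1 / \<epsilon> * sqrt (2 * ln (1.25 / \<delta>)) \<le>
      1 / \<epsilon> * (sqrt (2 * (1 + ln 1.25 / ln (1 / \<delta>\<^sub>0))) * sqrt (ln (1 / \<delta>)))"
    using assms by (intro mult_left_mono) auto
  thus ?thesis by (simp add: noise_sigma_def)
qed

lemma E_S_pos: "E.S m > 0"
  by (simp add: E_S binomial_seq_pos)

text \<open>The constant is chosen before the probability space, the dimensions and all other
  parameters, so it depends on \<open>\<delta>\<^sub>0\<close> alone and serves all four
  matrices.\<close>

theorem theorem6:
  fixes \<delta>\<^sub>0 :: real
  assumes "0 < \<delta>\<^sub>0" and "\<delta>\<^sub>0 < 1"
  shows "\<exists>c>0. \<forall>(M :: 'w measure) n b k d t \<zeta> \<epsilon> \<delta> \<beta> \<mu> C X Z.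
    prob_space M \<longrightarrow>
    1 \<le> b \<longrightarrow> b \<le> n \<longrightarrow> k = max_part n b \<longrightarrow> 1 \<le> d \<longrightarrow> t \<in> {1..n} \<longrightarrow> \<zeta> = 1 \<longrightarrow>
    0 < \<epsilon> \<longrightarrow> \<epsilon> < 1 \<longrightarrow> 0 < \<delta> \<longrightarrow> \<delta> \<le> \<delta>\<^sub>0 \<longrightarrow> 0 < \<beta> \<longrightarrow> \<beta> < 1 \<longrightarrow>
    bernoulli_rows M n d \<mu> X \<longrightarrow>
    gaussian_entries M n d (noise_variance d k b \<zeta> \<epsilon> \<delta> C) Z \<longrightarrow>
    indep_matrices M n d X Z \<longrightarrow>
    (let error_within = (\<lambda>r. measure M
           {\<omega> \<in> space M. vec_l2 (private_mean n C (X \<omega>) (Z \<omega>) t - \<mu>) \<le> r})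
     in (C = D_Toep n \<and> 2 \<le> t \<longrightarrow>
           1 - 2 * \<beta> \<le> error_within (c * rate_D_Toep n k d \<zeta> \<epsilon> \<delta> \<beta> t)) \<and>
        (C = E1_sqrt n \<and> 2 \<le> t \<longrightarrow>
           1 - 2 * \<beta> \<le> error_within (c * rate_E1_sqrt n k d \<zeta> \<epsilon> \<delta> \<beta> t)) \<and>
        (C = banded_inverse b (D_Toep n) \<and> 1 < real n / real k \<longrightarrow>
           1 - 2 * \<beta> \<le> error_within (c * rate_D_Toep_banded n k d \<zeta> \<epsilon> \<delta> \<beta> t)) \<and>
        (C = banded_inverse (nat \<lceil>ln (real b)\<rceil>) (E1_sqrt n) \<and> 1 \<le> ln (real n / real k) \<longrightarrow>
           1 - 2 * \<beta> \<le> error_within (c * rate_E1_sqrt_banded n k d \<zeta> \<epsilon> \<delta> \<beta> t)))"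
proof -
  define \<kappa> where "\<kappa> = sqrt (2 * (1 + ln 1.25 / ln (1 / \<delta>\<^sub>0)))"
  \<comment> \<open>400 is twice the largest of the numerical constants 30, 5, 200 and 60 of the
    four error lemmas.\<close>
  define c where "c = max 1 (400 * \<kappa>)"
  have "ln (1 / \<delta>\<^sub>0) > 0" using assms by simp
  hence \<kappa>: "\<kappa> \<ge> 0" unfolding \<kappa>_def by simp
  have c1: "1 \<le> c" by (simp add: c_def)
  have cK: "2 * \<kappa> * K \<le> c" if "K \<le> 200" for K
  proof -
    have "2 * \<kappa> * K \<le> 2 * \<kappa> * 200" using that \<kappa> by (intro mult_left_mono) auto
    also have "\<dots> \<le> c" by (simp add: c_def)
    finally show ?thesis .
  qed
  \<comment> \<open>\<open>P\<close> abbreviates the probability statement, so that only the matrix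
    and its rate differ between the four goals.\<close>
  have main: "(C = D_Toep n \<and> 2 \<le> t \<longrightarrow> P (rate_D_Toep n k d 1 \<epsilon> \<delta> \<beta> t)) \<and>
      (C = E1_sqrt n \<and> 2 \<le> t \<longrightarrow> P (rate_E1_sqrt n k d 1 \<epsilon> \<delta> \<beta> t)) \<and>
      (C = banded_inverse b (D_Toep n) \<and> 1 < real n / real k \<longrightarrow>
        P (rate_D_Toep_banded n k d 1 \<epsilon> \<delta> \<beta> t)) \<and>
      (C = banded_inverse (nat \<lceil>ln (real b)\<rceil>) (E1_sqrt n) \<and> 1 \<le> ln (real n / real k) \<longrightarrow>
        P (rate_E1_sqrt_banded n k d 1 \<epsilon> \<delta> \<beta> t))"
    if M: "prob_space M" and b: "1 \<le> b" "b \<le> n" and k: "k = max_part n b" and d: "1 \<le> d"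
      and t: "1 \<le> t" "t \<le> n" and \<epsilon>: "0 < \<epsilon>" and \<delta>: "0 < \<delta>" "\<delta> \<le> \<delta>\<^sub>0" and \<beta>: "0 < \<beta>" "\<beta> < 1"
      and X: "bernoulli_rows M n d \<mu> X"
      and Z: "gaussian_entries M n d (noise_variance d k b 1 \<epsilon> \<delta> C) Z"
      and P: "P = (\<lambda>r. 1 - 2 * \<beta> \<le>
        measure M {\<omega> \<in> space M. vec_l2 (private_mean n C (X \<omega>) (Z \<omega>) t - \<mu>) \<le> c * r})"
    for M :: "'w measure" and n b k d t \<epsilon> \<delta> \<beta> \<mu> C X Z P
  proof (intro conjI impI; elim conjE)
    have \<delta>1: "\<delta> < 1" using \<delta> assms by simp
    note \<sigma> = noise_sigma_le[OF \<delta> assms(2) \<epsilon>, folded \<kappa>_def]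
    note params = t d \<beta> \<epsilon> \<delta>(1) \<delta>1 \<sigma> c1
    have k1: "1 \<le> k" and n1: "1 \<le> n" using max_part_bounds(1)[OF b k] b by auto
    {
      assume C: "C = D_Toep n" and t2: "2 \<le> t"
      show "P (rate_D_Toep n k d 1 \<epsilon> \<delta> \<beta> t)"
        unfolding P C D_Toep_eq
      proof (rule D.toeplitz_error_rate[OF M X Z[unfolded C D_Toep_eq] D_S_pos error_D_Toep[OF b k t2 t(2)] _ _ params])
        show "0 \<le> 1 / (sqrt t * ln t) * (sqrt k + k / sqrt n * sqrt (ln k * ln n))"
          using t k1 n1 by simp
        show "rate_D_Toep n k d 1 \<epsilon> \<delta> \<beta> t = sampling_rate d 1 \<beta> t +
          1 / (sqrt t * ln t) * (sqrt k + k / sqrt n * sqrt (ln k * ln n)) * sqrt d *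
          (sqrt (ln (1 / \<delta>)) / \<epsilon>) * (sqrt d + sqrt (ln (1 / \<beta>)))"
          by (simp add: rate_D_Toep_def real_sqrt_mult divide_inverse mult_ac)
      qed (use cK[of 30] in simp_all)
    next
      assume C: "C = E1_sqrt n" and t2: "2 \<le> t"
      show "P (rate_E1_sqrt n k d 1 \<epsilon> \<delta> \<beta> t)"
        unfolding P C E1_sqrt_eq
      proof (rule E.toeplitz_error_rate[OF M X Z[unfolded C E1_sqrt_eq] E_S_pos error_E1_sqrt[OF b k t2 t(2)] _ _ params])
        show "0 \<le> sqrt (ln t) * (sqrt (k * ln n) + k) / t" using t n1 by simp
        show "rate_E1_sqrt n k d 1 \<epsilon> \<delta> \<beta> t = sampling_rate d 1 \<beta> t +
          sqrt (ln t) * (sqrt (k * ln n) + k) / t * sqrt d *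
          (sqrt (ln (1 / \<delta>)) / \<epsilon>) * (sqrt d + sqrt (ln (1 / \<beta>)))"
          by (simp add: rate_E1_sqrt_def real_sqrt_mult divide_inverse mult_ac)
      qed (use cK[of 5] in simp_all)
    next
      assume C: "C = banded_inverse b (D_Toep n)" and nk: "1 < real n / real k"
      have C': "C = toeplitz n (D.banded b)"
        unfolding C D_Toep_eq by (rule D.banded_inverse_toeplitz_a[OF b(1)])
      show "P (rate_D_Toep_banded n k d 1 \<epsilon> \<delta> \<beta> t)"
        unfolding P C'
      proof (rule D.banded_error_rate[OF M X Z[unfolded C'] D_S_pos b(1) error_D_Toep_banded[OF b k t nk] _ _ params])
        show "0 \<le> sqrt k / sqrt (t * ln (n / k)) * (1 + sqrt (n / (real k * real t)))"
          using nk by simp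
        show "rate_D_Toep_banded n k d 1 \<epsilon> \<delta> \<beta> t = sampling_rate d 1 \<beta> t +
          sqrt k / sqrt (t * ln (n / k)) * (1 + sqrt (n / (real k * real t))) * sqrt d *
          (sqrt (ln (1 / \<delta>)) / \<epsilon>) * (sqrt d + sqrt (ln (1 / \<beta>)))"
          by (simp add: rate_D_Toep_banded_def real_sqrt_mult divide_inverse mult_ac)
      qed (use cK[of 200] in simp_all)
    next
      assume C: "C = banded_inverse (nat \<lceil>ln (real b)\<rceil>) (E1_sqrt n)" and L: "1 \<le> ln (real n / real k)"
      define p where "p = nat \<lceil>ln (real b)\<rceil>"
      have p1: "1 \<le> p" by (rule bandwidth_ln_bounds(3)[OF b k L p_def])
      have C': "C = toeplitz n (E.banded p)"
        unfolding C E1_sqrt_eq p_def[symmetric] by (rule E.banded_inverse_toeplitz_a[OF p1])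
      show "P (rate_E1_sqrt_banded n k d 1 \<epsilon> \<delta> \<beta> t)"
        unfolding P C'
      proof (rule E.banded_error_rate[OF M X Z[unfolded C'] E_S_pos p1 error_E1_sqrt_banded[OF b k t(1) L p_def] _ _ params])
        show "0 \<le> sqrt k / sqrt t *
          (sqrt (ln (ln (real n / real k))) + sqrt (real k * ln (real n / real k) / real n)) *
          (sqrt k / sqrt (ln (real n / real k)) + sqrt (ln (ln (real n / real k))) / sqrt t)"
          using L by simp
        show "rate_E1_sqrt_banded n k d 1 \<epsilon> \<delta> \<beta> t = sampling_rate d 1 \<beta> t +
          sqrt k / sqrt t *
          (sqrt (ln (ln (real n / real k))) + sqrt (real k * ln (real n / real k) / real n)) *
          (sqrt k / sqrt (ln (real n / real k)) + sqrt (ln (ln (real n / real k))) / sqrt t) * sqrt d *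
          (sqrt (ln (1 / \<delta>)) / \<epsilon>) * (sqrt d + sqrt (ln (1 / \<beta>)))"
          by (simp add: rate_E1_sqrt_banded_def real_sqrt_mult divide_inverse mult_ac)
      qed (use cK[of 60] in simp_all)
    }
  qed
  show ?thesis
    unfolding Let_def
  proof (rule exI[of _ c], rule conjI, goal_cases)
    case 1
    show ?case using c1 by simp
  next
    case 2
    show ?case
    proof (intro allI impI, goal_cases)
      case (1 M n b k d t \<zeta> \<epsilon> \<delta> \<beta> \<mu> C X Z)
      hence t: "1 \<le> t" "t \<le> n" and \<zeta>: "\<zeta> = 1" by auto
      show ?case unfolding \<zeta>
        by (rule main[OF 1(1-5) t 1(8,10-13,14) 1(15)[unfolded \<zeta>] refl])
    qed
  qed
qed

end
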